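(* Let $\mu$ be an extended complex valued measure on $[0,\infty)$ with $\mu(\{0\})=0$, extended to an even measure on $\mathbb{R}$ (also denoted $\mu$). Assume that there exist $Q,r>0$ such that: 1. $$|\!|\!|\mu|\!|\!|_Q:=\sup_{u\in[0,\infty)}\frac{|\mu|([0,u))}{(u+2)^Q}<\infty;$$ 2. there are constants $c_1,C>0$ such that $$\left|\int_{\mathbb{R}}\exp(-u^2t)\,d\mu(u)\right|\le c_1t^{-C}\exp(-r^2/t)\,|\!|\!|\mu|\!|\!|_Q,\qquad0<t\le1.$$ Let $H:[0,\infty)\to\mathbb{R}$, let $S>Q+1$ be an integer, and suppose that there exists a measure $H^{[S]}$ on $[0,\infty)$ such that $$H(u)=\int_0^\infty(v^2-u^2)_+^S\,dH^{[S]}(v),\qquad u\ge0,$$ and $$V_{Q,S}(H)=\max\left(\int_0^\infty(v+2)^Qv^{2S}\,d|H^{[S]}|(v),\ \int_0^\infty(v+2)^Qv^S\,d|H^{[S]}|(v)\right)<\infty.$$ Then for all $n\ge1$, $$\left|\int_0^\infty H(u/n)\,d\mu(u)\right|\le c\,\frac{n^Q}{\max(1,(nr)^S)}\,V_{Q,S}(H)\,|\!|\!|\mu|\!|\!|_Q,$$ where $c>0$ is a constant depending only on $Q,S,c_1,C$ (in particular independent of $n$, $r$, $H$ and $\mu$).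
   Context: "Measure" on $\mathbb{R}$ or $[0,\infty)$ means an extended complex valued Borel measure having bounded total variation on compact intervals; $|\mu|$ is its total variation measure. A measure $\mu$ on $\mathbb{R}$ is even if $\mu((-u,u))=2\mu([0,u))$ for all $u>0$ and $\mu(\{0\})=0$; a measure $\mu$ on $[0,\infty)$ with $\mu(\{0\})=0$ is extended to $\mathbb{R}$ as the even (reflection invariant) measure agreeing with $\mu$ on Borel subsets of $[0,\infty)$. For real $x$, $x_+^S=x^S$ if $x>0$ and $x_+^S=0$ if $x\le0$. *)

theory Defs
  imports "HOL-Analysis.Analysis"
begin

text \<open>
  A measure on a Borel set \<open>X\<close> of reals (here \<open>X = UNIV\<close> or \<open>X = {0..}\<close>) is a complex
  Borel measure of bounded total variation on compact intervals.  On unbounded sets such a measure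
  need not have a value (the total variation may be infinite there), so it is modelled as a
  set function whose values on the bounded Borel subsets of \<open>X\<close> are the relevant data; values on
  all other sets are ignored by every definition below.
\<close>

definition bounded_borel :: "real set \<Rightarrow> real set set" where
  "bounded_borel B = {A \<in> sets borel. A \<subseteq> B \<and> bounded A}"

text \<open>
  The usual supremum over partitions.  Finite disjoint families of bounded Borel subsets of \<open>B\<close>
  are used instead of partitions of \<open>B\<close>; for bounded \<open>B\<close> adding the missing remainder to the
  family only increases the sum.
\<close>

definition total_variation :: "(real set \<Rightarrow> complex) \<Rightarrow> real set \<Rightarrow> ennreal" where
  "total_variation \<mu> B =
     (SUP P \<in> {P. finite P \<and> disjoint P \<and> P \<subseteq> bounded_borel B}. \<Sum>A\<in>P. ennreal (cmod (\<mu> A)))"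

definition measure_on :: "real set \<Rightarrow> (real set \<Rightarrow> complex) \<Rightarrow> bool" where
  "measure_on X \<mu> \<longleftrightarrow>
     (\<forall>A :: nat \<Rightarrow> real set. disjoint_family A \<longrightarrow> range A \<subseteq> bounded_borel X \<longrightarrow> bounded (\<Union>i. A i)
        \<longrightarrow> (\<lambda>i. \<mu> (A i)) sums \<mu> (\<Union>i. A i)) \<and>
     (\<forall>a b. total_variation \<mu> (X \<inter> {a..b}) < \<infinity>)"

text \<open>
  The positive measure on the Borel subsets of \<open>X\<close> with values \<open>v B\<close>.  It is only applied to
  the total, positive and negative variations of a measure on \<open>X\<close>, each of which is countably additive.
\<close>

definition borel_measure_on :: "real set \<Rightarrow> (real set \<Rightarrow> ennreal) \<Rightarrow> real measure" where
  "borel_measure_on X v =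
     measure_of (space (restrict_space borel X)) (sets (restrict_space borel X)) v"

definition variation_measure :: "real set \<Rightarrow> (real set \<Rightarrow> complex) \<Rightarrow> real measure" where
  "variation_measure X \<mu> = borel_measure_on X (total_variation \<mu>)"

text \<open>
  The positive variation \<open>\<sigma>\<^sup>+(B) = sup {\<sigma>(A) | A \<subseteq> B}\<close> of a real-valued \<open>\<sigma>\<close>; \<open>ennreal\<close> truncates
  negative values to 0, which does not affect the supremum because \<open>\<sigma>({}) = 0\<close>.
  The negative variation is the positive variation of \<open>-\<sigma>\<close>.
\<close>

definition positive_variation :: "(real set \<Rightarrow> real) \<Rightarrow> real set \<Rightarrow> ennreal" where
  "positive_variation \<sigma> B = (SUP A \<in> bounded_borel B. ennreal (\<sigma> A))"

text \<open>
  Integration of a real function against a signed or complex measure through the Jordan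
  decompositions: \<open>\<integral>f d\<sigma> = \<integral>f d\<sigma>\<^sup>+ - \<integral>f d\<sigma>\<^sup>-\<close> and \<open>\<integral>f d\<mu> = \<integral>f d(Re \<mu>) + \<i> \<integral>f d(Im \<mu>)\<close>.
\<close>

definition signed_integral :: "real set \<Rightarrow> (real set \<Rightarrow> real) \<Rightarrow> (real \<Rightarrow> real) \<Rightarrow> real" where
  "signed_integral X \<sigma> f =
     integral\<^sup>L (borel_measure_on X (positive_variation \<sigma>)) f
     - integral\<^sup>L (borel_measure_on X (positive_variation (\<lambda>A. - \<sigma> A))) f"

definition measure_integral :: "real set \<Rightarrow> (real set \<Rightarrow> complex) \<Rightarrow> (real \<Rightarrow> real) \<Rightarrow> complex" where
  "measure_integral X \<mu> f =
     Complex (signed_integral X (\<lambda>A. Re (\<mu> A)) f) (signed_integral X (\<lambda>A. Im (\<mu> A)) f)"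

text \<open>
  The reflection invariant extension to \<open>UNIV\<close> of a measure on \<open>{0..}\<close> without an atom at 0;
  the two lemmas that follow confirm that it extends \<open>\<mu>\<close> and is even.
\<close>

definition even_extension :: "(real set \<Rightarrow> complex) \<Rightarrow> real set \<Rightarrow> complex" where
  "even_extension \<mu> B = \<mu> (B \<inter> {0..}) + \<mu> (uminus ` B \<inter> {0..})"

lemma measure_on_empty:
  assumes "measure_on X \<mu>"
  shows "\<mu> {} = 0"
proof -
  have "(\<lambda>i::nat. \<mu> {}) sums \<mu> (\<Union>i::nat. {})"
    using assms unfolding measure_on_def
    by (elim conjE allE[where x = "\<lambda>_. {}"]) (auto simp: bounded_borel_def disjoint_family_on_def)
  then have "summable (\<lambda>i::nat. \<mu> {})"
    by (rule sums_summable)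
  then show ?thesis
    by (simp add: summable_const_iff)
qed

lemma even_extension_eq:
  assumes "measure_on {0..} \<mu>" "\<mu> {0} = 0" "B \<subseteq> {0..}"
  shows "even_extension \<mu> B = \<mu> B"
proof -
  have "uminus ` B \<inter> {0..} = {} \<or> uminus ` B \<inter> {0..} = {0}"
    using assms(3) by force
  then have "\<mu> (uminus ` B \<inter> {0..}) = 0"
    using assms(2) measure_on_empty[OF assms(1)] by metis
  moreover have "B \<inter> {0..} = B"
    using assms(3) by blast
  ultimately show ?thesis
    by (simp add: even_extension_def)
qed

lemma even_extension_reflect: "even_extension \<mu> (uminus ` B) = even_extension \<mu> B"
  by (simp add: even_extension_def image_image add.commute)

definition growth_norm :: "real \<Rightarrow> (real set \<Rightarrow> complex) \<Rightarrow> ennreal" where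
  "growth_norm Q \<mu> = (SUP u\<in>{0..}. total_variation \<mu> {0..<u} / ennreal ((u + 2) powr Q))"

definition truncated_power :: "nat \<Rightarrow> real \<Rightarrow> real" where
  "truncated_power S x = (if x > 0 then x ^ S else 0)"

text \<open>
  \<open>V\<^bsub>Q,S\<^esub>(H)\<close>; its argument is the representing measure \<open>H\<^bsup>[S]\<^esup>\<close> rather than \<open>H\<close>.
\<close>

definition V_norm :: "real \<Rightarrow> nat \<Rightarrow> (real set \<Rightarrow> complex) \<Rightarrow> ennreal" where
  "V_norm Q S HS =
     max (\<integral>\<^sup>+v. ennreal ((v + 2) powr Q * v ^ (2 * S)) \<partial>variation_measure {0..} HS)
         (\<integral>\<^sup>+v. ennreal ((v + 2) powr Q * v ^ S) \<partial>variation_measure {0..} HS)"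

end

theory Submission
  imports Defs "HOL-Complex_Analysis.Complex_Analysis" "HOL-Real_Asymp.Real_Asymp"
begin

text \<open>
  By Fubini it suffices to bound \<open>I(x) = \<integral>(x\<^sup>2 - u\<^sup>2)\<^sub>+\<^sup>S d\<mu>(u)\<close>, both by \<open>x\<^bsup>2S\<^esup> (x + 2)\<^bsup>Q\<^esup>\<close>, which is immediate,
  and by \<open>(x/r)\<^sup>S (x + 2)\<^bsup>Q\<^esup>\<close>, up to a constant multiple of the norm of \<open>\<mu>\<close>.  The function
  \<open>L(z) = \<integral>exp(-z u\<^sup>2) d\<mu>(u)\<close> is holomorphic on \<open>Re z > 0\<close> with \<open>L(z) = O((1 + 1/Re z)\<^bsup>Q/2\<^esup>)\<close>.  In the
  variable \<open>w = 1/z\<close>, a Phragmen-Lindelof argument propagates the decay \<open>exp(-r\<^sup>2 w)\<close> from the real axis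
  to the half plane and yields the extra factor \<open>exp(-r\<^sup>2 Re(1/z)/2)\<close>.  In the Laplace inversion formula
  \<open>I(x) = S!/(2\<pi>) \<integral>exp((a + iy) x\<^sup>2) L(a + iy) / (a + iy)\<^bsup>S+1\<^esup> dy\<close> with \<open>a = 1/x\<^sup>2\<close> this factor suppresses
  the range \<open>\<bar>y\<bar> < r/x\<close>, so that the integral is \<open>O((1 + x\<^sup>2)\<^bsup>Q/2\<^esup> (x/r)\<^sup>S)\<close>.
\<close>

section \<open>Variations of complex measures\<close>

text \<open>The hypothesis makes the transform small only on the real segment
  \<open>0 < t \<le> 1\<close>, and only through cancellation inside \<mu>, while inversion needs it
  on a whole vertical line. Hence the separation of roles below: integrability and polynomial growth
  are proved for each positive part of \<mu> separately, decay only for their combination, and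
  absolute values are not taken before that combination has been formed. In w = 1/z the exponential
  rate is read off the positive real axis, but the multiplicative constant off the boundary line.
  The constants \<open>c1\<close> and \<open>C\<close> supply some finite bound on the real axis;
  the Phragmen-Lindelof step then replaces it by the boundary bound, so that the witness is a
  formula in \<open>Q\<close> and \<open>S\<close>. The power (x/r)^S is a matter of scale: with B =
  r / (sqrt 2 * x) the decay factor on the line is exp(-B^2/|z|^2), so the integral of |z|^(-S-1) is
  effectively cut off at |z| of order B and has size B^(-S).\<close>

definition bounded_additive :: "real set \<Rightarrow> (real set \<Rightarrow> 'a::real_normed_vector) \<Rightarrow> bool" where
  "bounded_additive X \<sigma> \<longleftrightarrow>
     (\<forall>A :: nat \<Rightarrow> real set. disjoint_family A \<longrightarrow> range A \<subseteq> bounded_borel X \<longrightarrow> bounded (\<Union>i. A i)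
        \<longrightarrow> (\<lambda>i. \<sigma> (A i)) sums \<sigma> (\<Union>i. A i))"

lemma bounded_additive_of_measure_on: "measure_on X \<mu> \<Longrightarrow> bounded_additive X \<mu>"
  by (simp add: measure_on_def bounded_additive_def)

text \<open>Taken with the functional \<open>\<lambda>z. Re (z / \<i> ^ k)\<close>, it leads from a
  complex measure to four real set functions; this is why \<open>bounded_additive\<close> allows
  values in any normed space.\<close>

lemma bounded_additive_linear:
  assumes "bounded_additive X \<sigma>" "bounded_linear f"
  shows "bounded_additive X (\<lambda>A. f (\<sigma> A))"
  using assms unfolding bounded_additive_def by (auto intro: bounded_linear.sums)

lemma bounded_borel_empty [simp]: "{} \<in> bounded_borel X"
  by (simp add: bounded_borel_def)

lemma bounded_borel_mono: "A \<in> bounded_borel B \<Longrightarrow> B \<subseteq> C \<Longrightarrow> A \<in> bounded_borel C"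
  by (auto simp: bounded_borel_def)

lemma bounded_borel_Int: "A \<in> bounded_borel B \<Longrightarrow> C \<in> sets borel \<Longrightarrow> A \<inter> C \<in> bounded_borel (B \<inter> C)"
  by (auto simp: bounded_borel_def intro: bounded_subset)

lemma bounded_borel_Un:
  "A \<in> bounded_borel X \<Longrightarrow> B \<in> bounded_borel X \<Longrightarrow> A \<union> B \<in> bounded_borel X"
  by (auto simp: bounded_borel_def)

lemma bounded_additive_empty:
  assumes "bounded_additive X \<sigma>"
  shows "\<sigma> {} = 0"
proof -
  have "(\<lambda>i::nat. \<sigma> {}) sums \<sigma> (\<Union>i::nat. {})"
    using assms unfolding bounded_additive_def
    by (elim allE[where x = "\<lambda>_. {}"]) (auto simp: disjoint_family_on_def)
  then show ?thesis
    using sums_summable summable_const_iff by blast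
qed

text \<open>The traces \<open>A \<inter> B i\<close> inherit boundedness from \<open>A\<close>, so
  the cover itself may consist of unbounded Borel sets.\<close>

lemma bounded_additive_sums:
  assumes "bounded_additive X \<sigma>" "disjoint_family B" "range B \<subseteq> sets borel"
    and "A \<in> bounded_borel X" "A \<subseteq> (\<Union>i. B i)"
  shows "(\<lambda>i. \<sigma> (A \<inter> B i)) sums \<sigma> A"
proof -
  have eq: "(\<Union>i. A \<inter> B i) = A"
    using assms(5) by blast
  have "range (\<lambda>i. A \<inter> B i) \<subseteq> bounded_borel X"
    using assms(3,4) by (auto simp: bounded_borel_def intro: bounded_subset)
  moreover have "disjoint_family (\<lambda>i. A \<inter> B i)"
    using assms(2) by (auto simp: disjoint_family_on_def)
  moreover have "bounded (\<Union>i. A \<inter> B i)"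
    unfolding eq using assms(4) by (simp add: bounded_borel_def)
  ultimately show ?thesis
    using assms(1) eq unfolding bounded_additive_def by metis
qed

lemma bounded_additive_Un:
  assumes "bounded_additive X \<sigma>" "A \<in> bounded_borel X" "B \<in> bounded_borel X" "A \<inter> B = {}"
  shows "\<sigma> (A \<union> B) = \<sigma> A + \<sigma> B"
proof -
  let ?F = "\<lambda>i::nat. if i = 0 then A else if i = 1 then B else {}"
  have "(\<lambda>i. \<sigma> ((A \<union> B) \<inter> ?F i)) sums \<sigma> (A \<union> B)"
  proof (rule bounded_additive_sums[OF assms(1)])
    show "A \<union> B \<subseteq> (\<Union>i. ?F i)"
      by (auto split: if_splits)
  qed (use assms bounded_borel_Un in \<open>auto simp: disjoint_family_on_def bounded_borel_def\<close>)
  moreover have "(\<lambda>i. \<sigma> ((A \<union> B) \<inter> ?F i)) sums (\<Sum>i\<in>{0, 1}. \<sigma> ((A \<union> B) \<inter> ?F i))"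
    by (rule sums_finite) (auto simp: bounded_additive_empty[OF assms(1)])
  ultimately have "\<sigma> (A \<union> B) = (\<Sum>i\<in>{0, 1::nat}. \<sigma> ((A \<union> B) \<inter> ?F i))"
    by (rule sums_unique2)
  moreover have "(A \<union> B) \<inter> A = A" "(A \<union> B) \<inter> B = B"
    by auto
  ultimately show ?thesis
    by simp
qed



text \<open>Variations are suprema, and these inequalities are what suprema give directly: countable
  subadditivity by cutting each competitor along the pieces, finite superadditivity by joining
  competitors on disjoint sets. Monotonicity then bounds all partial sums by the value of the full
  union.\<close>

lemma countably_additive_of_superadditive:
  fixes v :: "'a set \<Rightarrow> ennreal"
  assumes "sigma_algebra \<Omega> M"
    and le: "\<And>B :: nat \<Rightarrow> 'a set. range B \<subseteq> M \<Longrightarrow> disjoint_family B \<Longrightarrow> v (\<Union>i. B i) \<le> (\<Sum>i. v (B i))"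
    and super: "\<And>A B. A \<in> M \<Longrightarrow> B \<in> M \<Longrightarrow> A \<inter> B = {} \<Longrightarrow> v A + v B \<le> v (A \<union> B)"
    and mono: "\<And>A B. A \<in> M \<Longrightarrow> B \<in> M \<Longrightarrow> A \<subseteq> B \<Longrightarrow> v A \<le> v B"
    and empty: "v {} = 0"
  shows "countably_additive M v"
proof (rule countably_additiveI)
  interpret sigma_algebra \<Omega> M by fact
  fix B :: "nat \<Rightarrow> 'a set"
  assume B: "range B \<subseteq> M" "disjoint_family B" "(\<Union>i. B i) \<in> M"
  have part: "(\<Sum>i<n. v (B i)) \<le> v (\<Union>i<n. B i)" for n
  proof (induction n)
    case 0
    then show ?case by simp
  next
    case (Suc n)
    have "(\<Sum>i<Suc n. v (B i)) \<le> v (\<Union>i<n. B i) + v (B n)"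
      using Suc.IH by (simp add: add_right_mono)
    also have "\<dots> \<le> v ((\<Union>i<n. B i) \<union> B n)"
    proof (rule super)
      show "(\<Union>i<n. B i) \<inter> B n = {}"
        using B(2) by (auto simp: disjoint_family_on_def) (metis disjoint_iff less_irrefl)
    qed (use B in auto)
    also have "(\<Union>i<n. B i) \<union> B n = (\<Union>i<Suc n. B i)"
      by (auto simp: less_Suc_eq)
    finally show ?case .
  qed
  have "(\<Sum>i. v (B i)) = (SUP n. \<Sum>i<n. v (B i))"
    by (rule suminf_eq_SUP)
  also have "\<dots> \<le> v (\<Union>i. B i)"
  proof (rule SUP_least)
    fix n
    have "v (\<Union>i<n. B i) \<le> v (\<Union>i. B i)"
      using B by (intro mono) auto
    then show "(\<Sum>i<n. v (B i)) \<le> v (\<Union>i. B i)"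
      using part order_trans by blast
  qed
  finally show "(\<Sum>i. v (B i)) = v (\<Union>i. B i)"
    using le[OF B(1,2)] by (rule antisym)
qed

lemma ennreal_add_le: "ennreal (a + b) \<le> ennreal a + ennreal b"
  by (cases "a \<ge> 0"; cases "b \<ge> 0") (auto simp: ennreal_neg intro: ennreal_leI)

text \<open>Negative terms are truncated to 0 on the right, which only increases the partial
  sums.\<close>

lemma ennreal_suminf_ge:
  fixes f :: "nat \<Rightarrow> real"
  assumes "f sums s"
  shows "ennreal s \<le> (\<Sum>i. ennreal (f i))"
proof (rule LIMSEQ_le_const2)
  show "(\<lambda>n. ennreal (\<Sum>i<n. f i)) \<longlonglongrightarrow> ennreal s"
    using assms by (intro tendsto_ennrealI) (simp add: sums_def)
  have "ennreal (\<Sum>i<n. f i) \<le> (\<Sum>i<n. ennreal (f i))" for n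
  proof (induction n)
    case (Suc n)
    have "ennreal (\<Sum>i<Suc n. f i) \<le> ennreal (\<Sum>i<n. f i) + ennreal (f n)"
      by (simp add: ennreal_add_le)
    then show ?case
      using add_right_mono[OF Suc, of "ennreal (f n)"] unfolding sum.lessThan_Suc[of "\<lambda>i. ennreal (f i)"]
      by (rule order_trans)
  qed simp
  then show "\<exists>N. \<forall>n\<ge>N. ennreal (\<Sum>i<n. f i) \<le> (\<Sum>i. ennreal (f i))"
    by (meson order_trans sum_le_suminf summableI finite_lessThan zero_le)
qed

lemma SUP_add_SUP_le_ennreal:
  fixes f :: "'a \<Rightarrow> ennreal"
  assumes "I \<noteq> {}" "J \<noteq> {}" and le: "\<And>i j. i \<in> I \<Longrightarrow> j \<in> J \<Longrightarrow> f i + g j \<le> c"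
  shows "(SUP i\<in>I. f i) + (SUP j\<in>J. g j) \<le> c"
proof -
  have "(SUP i\<in>I. f i) + (SUP j\<in>J. g j) = (SUP i\<in>I. f i + (SUP j\<in>J. g j))"
    using assms(1) by (simp add: ennreal_SUP_add_left)
  also have "\<dots> = (SUP i\<in>I. SUP j\<in>J. f i + g j)"
    using assms(2) by (simp add: ennreal_SUP_add_right)
  also have "\<dots> \<le> c"
    using le by (intro SUP_least) auto
  finally show ?thesis .
qed

lemma sets_restrict_borel: "sets (restrict_space borel X) = {A \<in> sets borel. A \<subseteq> X}"
  if "X \<in> sets borel" for X :: "real set"
  using that by (auto simp: sets_restrict_space_iff sets_restrict_space)

lemma positive_variation_empty: "\<sigma> {} = 0 \<Longrightarrow> positive_variation \<sigma> {} = 0"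
  by (auto simp: positive_variation_def bounded_borel_def intro!: antisym SUP_least)

lemma countably_additive_positive_variation:
  fixes \<sigma> :: "real set \<Rightarrow> real"
  assumes \<sigma>: "bounded_additive X \<sigma>" and X: "X \<in> sets borel"
  shows "countably_additive (sets (restrict_space borel X)) (positive_variation \<sigma>)"
proof (rule countably_additive_of_superadditive[OF sets.sigma_algebra_axioms])
  note [simp] = sets_restrict_borel[OF X]
  show "positive_variation \<sigma> {} = 0"
    by (simp add: positive_variation_empty bounded_additive_empty[OF \<sigma>])
  show "positive_variation \<sigma> A \<le> positive_variation \<sigma> B" if "A \<subseteq> B" for A B
    unfolding positive_variation_def using that by (intro SUP_subset_mono) (auto intro: bounded_borel_mono)
  show "positive_variation \<sigma> (\<Union>i. B i) \<le> (\<Sum>i. positive_variation \<sigma> (B i))"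
    if B: "range B \<subseteq> sets (restrict_space borel X)" "disjoint_family B" for B :: "nat \<Rightarrow> real set"
    unfolding positive_variation_def[of \<sigma> "\<Union>i. B i"]
  proof (rule SUP_least)
    fix A assume A: "A \<in> bounded_borel (\<Union>i. B i)"
    have "ennreal (\<sigma> A) \<le> (\<Sum>i. ennreal (\<sigma> (A \<inter> B i)))"
      using A B bounded_borel_mono[OF A UN_least[of UNIV B X]]
      by (intro ennreal_suminf_ge bounded_additive_sums[OF \<sigma>]) (auto simp: bounded_borel_def)
    also have "\<dots> \<le> (\<Sum>i. positive_variation \<sigma> (B i))"
    proof (intro suminf_le summableI)
      fix i
      show "ennreal (\<sigma> (A \<inter> B i)) \<le> positive_variation \<sigma> (B i)"
        unfolding positive_variation_def using A B bounded_borel_Int[OF A, of "B i"]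
        by (intro SUP_upper) (auto simp: bounded_borel_def)
    qed
    finally show "ennreal (\<sigma> A) \<le> (\<Sum>i. positive_variation \<sigma> (B i))" .
  qed
  show "positive_variation \<sigma> A + positive_variation \<sigma> B \<le> positive_variation \<sigma> (A \<union> B)"
    if AB: "A \<in> sets (restrict_space borel X)" "B \<in> sets (restrict_space borel X)" "A \<inter> B = {}" for A B
    unfolding positive_variation_def[of \<sigma> A] positive_variation_def[of \<sigma> B]
  proof (rule SUP_add_SUP_le_ennreal)
    fix C D assume CD: "C \<in> bounded_borel A" "D \<in> bounded_borel B"
    \<comment> \<open>Replacing a set of negative value by \<open>{}\<close> leaves its truncated
      value unchanged; afterwards both values are nonnegative, so that \<open>ennreal\<close> is
      additive on them.\<close>
    define C' D' where "C' = (if \<sigma> C \<ge> 0 then C else {})" and "D' = (if \<sigma> D \<ge> 0 then D else {})"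
    have nonneg: "\<sigma> C' \<ge> 0" "\<sigma> D' \<ge> 0"
      and eq: "ennreal (\<sigma> C) = ennreal (\<sigma> C')" "ennreal (\<sigma> D) = ennreal (\<sigma> D')"
      by (auto simp: C'_def D'_def bounded_additive_empty[OF \<sigma>] ennreal_neg)
    have C'D': "C' \<in> bounded_borel A" "D' \<in> bounded_borel B"
      using CD by (auto simp: C'_def D'_def)
    have "\<sigma> (C' \<union> D') = \<sigma> C' + \<sigma> D'"
      using C'D' AB by (intro bounded_additive_Un[OF \<sigma>]) (auto simp: bounded_borel_def)
    moreover have "C' \<union> D' \<in> bounded_borel (A \<union> B)"
      using C'D' by (auto intro!: bounded_borel_Un intro: bounded_borel_mono)
    ultimately show "ennreal (\<sigma> C) + ennreal (\<sigma> D) \<le> positive_variation \<sigma> (A \<union> B)"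
      using nonneg unfolding eq positive_variation_def
      by (metis SUP_upper ennreal_plus)
  qed (use bounded_borel_empty in blast)+
qed

lemma total_variation_mono: "A \<subseteq> B \<Longrightarrow> total_variation \<mu> A \<le> total_variation \<mu> B"
  unfolding total_variation_def by (intro SUP_subset_mono) (auto intro: bounded_borel_mono)

lemma total_variation_empty:
  assumes "\<mu> {} = 0"
  shows "total_variation \<mu> {} = 0"
proof -
  have "(\<Sum>A\<in>P. ennreal (cmod (\<mu> A))) = 0" if "P \<subseteq> bounded_borel {}" for P
    using that assms by (intro sum.neutral) (auto simp: bounded_borel_def)
  then show ?thesis
    unfolding total_variation_def by (intro antisym SUP_least) auto
qed

lemma countably_additive_total_variation:
  assumes \<mu>: "bounded_additive X \<mu>" and X: "X \<in> sets borel"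
  shows "countably_additive (sets (restrict_space borel X)) (total_variation \<mu>)"
proof (rule countably_additive_of_superadditive[OF sets.sigma_algebra_axioms])
  note [simp] = sets_restrict_borel[OF X] bounded_additive_empty[OF \<mu>]
  let ?fam = "\<lambda>B. {P. finite P \<and> disjoint P \<and> P \<subseteq> bounded_borel B}"
  show "total_variation \<mu> {} = 0"
    by (simp add: total_variation_empty)
  show "total_variation \<mu> A \<le> total_variation \<mu> B" if "A \<subseteq> B" for A B
    using that by (rule total_variation_mono)
  show "total_variation \<mu> (\<Union>i. B i) \<le> (\<Sum>i. total_variation \<mu> (B i))"
    if B: "range B \<subseteq> sets (restrict_space borel X)" "disjoint_family B" for B :: "nat \<Rightarrow> real set"
    unfolding total_variation_def[of \<mu> "\<Union>i. B i"]
  proof (rule SUP_least)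
    fix P assume P: "P \<in> ?fam (\<Union>i. B i)"
    have "(\<Sum>A\<in>P. ennreal (cmod (\<mu> A))) \<le> (\<Sum>A\<in>P. \<Sum>i. ennreal (cmod (\<mu> (A \<inter> B i))))"
    proof (rule sum_mono)
      fix A assume "A \<in> P"
      then have A: "A \<in> bounded_borel (\<Union>i. B i)"
        using P by auto
      have "(\<lambda>i. \<mu> (A \<inter> B i)) sums \<mu> A"
        using A B bounded_borel_mono[OF A UN_least[of UNIV B X]]
        by (intro bounded_additive_sums[OF \<mu>]) (auto simp: bounded_borel_def)
      then have lim: "(\<lambda>n. ennreal (cmod (\<Sum>i<n. \<mu> (A \<inter> B i)))) \<longlonglongrightarrow> ennreal (cmod (\<mu> A))"
        by (intro tendsto_ennrealI tendsto_norm) (simp add: sums_def)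
      have "ennreal (cmod (\<Sum>i<n. \<mu> (A \<inter> B i))) \<le> (\<Sum>i<n. ennreal (cmod (\<mu> (A \<inter> B i))))" for n
        by (simp add: sum_nonneg norm_sum ennreal_leI)
      then show "ennreal (cmod (\<mu> A)) \<le> (\<Sum>i. ennreal (cmod (\<mu> (A \<inter> B i))))"
        by (intro LIMSEQ_le_const2[OF lim])
          (meson order_trans sum_le_suminf summableI finite_lessThan zero_le)
    qed
    also have "\<dots> = (\<Sum>i. \<Sum>A\<in>P. ennreal (cmod (\<mu> (A \<inter> B i))))"
      by (rule suminf_sum[symmetric]) (rule summableI)
    also have "\<dots> \<le> (\<Sum>i. total_variation \<mu> (B i))"
    proof (intro suminf_le summableI)
      fix i
      \<comment> \<open>Distinct members of \<open>P\<close> are disjoint, so they can share a trace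
        on \<open>B i\<close> only if that trace is empty. Such terms vanish, and reindexing by
        traces loses nothing.\<close>
      have "(\<Sum>A\<in>P. ennreal (cmod (\<mu> (A \<inter> B i)))) = (\<Sum>A\<in>(\<lambda>A. A \<inter> B i) ` P. ennreal (cmod (\<mu> A)))"
      proof (subst sum.reindex_nontrivial)
        fix A A' assume AA': "A \<in> P" "A' \<in> P" "A \<noteq> A'" "A \<inter> B i = A' \<inter> B i"
        then have "A \<inter> A' = {}"
          using P by (auto simp: disjoint_def)
        then have "A \<inter> B i = {}"
          using AA'(4) by blast
        then show "ennreal (cmod (\<mu> (A \<inter> B i))) = 0"
          by simp
      qed (use P in \<open>auto simp: o_def\<close>)
      also have "\<dots> \<le> total_variation \<mu> (B i)"
        unfolding total_variation_def
      proof (rule SUP_upper)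
        have "disjoint ((\<lambda>A. A \<inter> B i) ` P)"
          using P by (fastforce simp: disjoint_def)
        then show "(\<lambda>A. A \<inter> B i) ` P \<in> ?fam (B i)"
          using P B by (auto simp: bounded_borel_def intro: bounded_subset)
      qed
      finally show "(\<Sum>A\<in>P. ennreal (cmod (\<mu> (A \<inter> B i)))) \<le> total_variation \<mu> (B i)" .
    qed
    finally show "(\<Sum>A\<in>P. ennreal (cmod (\<mu> A))) \<le> (\<Sum>i. total_variation \<mu> (B i))" .
  qed
  show "total_variation \<mu> A + total_variation \<mu> B \<le> total_variation \<mu> (A \<union> B)"
    if AB: "A \<in> sets (restrict_space borel X)" "B \<in> sets (restrict_space borel X)" "A \<inter> B = {}" for A B
    unfolding total_variation_def[of \<mu> A] total_variation_def[of \<mu> B]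
  proof (rule SUP_add_SUP_le_ennreal)
    fix P R assume PR: "P \<in> ?fam A" "R \<in> ?fam B"
    have disj: "C \<inter> D = {}" if "C \<in> P" "D \<in> R" for C D
      using that PR AB(3) by (fastforce simp: bounded_borel_def)
    \<comment> \<open>The two families can have only the empty set in common, and its value is 0;
      hence their sums add up to the sum over the union.\<close>
    have "(\<Sum>C\<in>P \<inter> R. ennreal (cmod (\<mu> C))) = 0"
      using disj by (intro sum.neutral) (metis Int_absorb Int_iff bounded_additive_empty[OF \<mu>] ennreal_0 norm_zero)
    then have "(\<Sum>C\<in>P. ennreal (cmod (\<mu> C))) + (\<Sum>C\<in>R. ennreal (cmod (\<mu> C)))
        = (\<Sum>C\<in>P \<union> R. ennreal (cmod (\<mu> C)))"
      using PR sum.union_inter[of P R "\<lambda>C. ennreal (cmod (\<mu> C))"] by simp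
    also have "\<dots> \<le> total_variation \<mu> (A \<union> B)"
      unfolding total_variation_def
    proof (rule SUP_upper)
      have "disjoint (P \<union> R)"
        using PR disj Int_commute unfolding disjoint_def Ball_def mem_Collect_eq Un_iff by metis
      then show "P \<union> R \<in> ?fam (A \<union> B)"
        using PR by (auto intro: bounded_borel_mono)
    qed
    finally show "(\<Sum>C\<in>P. ennreal (cmod (\<mu> C))) + (\<Sum>C\<in>R. ennreal (cmod (\<mu> C)))
        \<le> total_variation \<mu> (A \<union> B)" .
  qed (auto intro!: exI[of _ "{}"])
qed

section \<open>Positive measures generated by the variations\<close>

lemma sets_borel_measure_on [measurable_cong]: "sets (borel_measure_on X v) = sets (restrict_space borel X)"
  unfolding borel_measure_on_def
  by (metis sets.sigma_sets_eq sets_measure_of sets.space_closed)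

lemma space_borel_measure_on: "space (borel_measure_on X v) = X"
  using sets_eq_imp_space_eq[OF sets_borel_measure_on[of X v]] by (simp add: space_restrict_space)

lemma emeasure_borel_measure_on:
  assumes "countably_additive (sets (restrict_space borel X)) v" "v {} = 0" "A \<in> sets (restrict_space borel X)"
  shows "emeasure (borel_measure_on X v) A = v A"
  unfolding borel_measure_on_def using assms
  by (intro emeasure_measure_of_sigma) (auto simp: sets.sigma_algebra_axioms positive_def)





lemma positive_variation_le_total_variation:
  assumes "\<And>A. \<sigma> A \<le> cmod (\<mu> A)"
  shows "positive_variation \<sigma> B \<le> total_variation \<mu> B"
  unfolding positive_variation_def
proof (rule SUP_least)
  fix A assume A: "A \<in> bounded_borel B"
  have "ennreal (\<sigma> A) \<le> (\<Sum>A\<in>{A}. ennreal (cmod (\<mu> A)))"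
    using assms by (simp add: ennreal_leI)
  also have "\<dots> \<le> total_variation \<mu> B"
    unfolding total_variation_def using A by (intro SUP_upper) (auto simp: disjoint_def)
  finally show "ennreal (\<sigma> A) \<le> total_variation \<mu> B" .
qed


text \<open>A complex measure is treated as the combination of the positive measures
  \<open>(Re \<mu>)\<^sup>+\<close>, \<open>(Im \<mu>)\<^sup>+\<close>, \<open>(Re \<mu>)\<^sup>-\<close>, \<open>(Im \<mu>)\<^sup>-\<close> with the coefficients \<open>\<i> ^ k\<close>, \<open>k < 4\<close>.\<close>

definition variation_part :: "real set \<Rightarrow> (real set \<Rightarrow> complex) \<Rightarrow> nat \<Rightarrow> real measure" where
  "variation_part X \<mu> k = borel_measure_on X (positive_variation (\<lambda>A. Re (\<mu> A / \<i> ^ k)))"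

lemma emeasure_variation_part:
  assumes "bounded_additive X \<mu>" "X \<in> sets borel" "A \<in> sets borel" "A \<subseteq> X"
  shows "emeasure (variation_part X \<mu> k) A = positive_variation (\<lambda>A. Re (\<mu> A / \<i> ^ k)) A"
proof -
  have lin: "bounded_linear (\<lambda>z. Re (z / \<i> ^ k))"
    by (rule bounded_linear_compose[OF bounded_linear_Re bounded_linear_divide])
  note add = bounded_additive_linear[OF assms(1) lin]
  show ?thesis
    using assms unfolding variation_part_def
    by (intro emeasure_borel_measure_on countably_additive_positive_variation add positive_variation_empty
        bounded_additive_empty[OF add]) (auto simp: sets_restrict_borel)
qed

text \<open>The integrand is complex because exp(-z u^2) has to be integrated, and the family is
  arbitrary so that Fubini and dominated convergence can be applied to each positive member.\<close>

definition combined_integral :: "(nat \<Rightarrow> real measure) \<Rightarrow> (real \<Rightarrow> complex) \<Rightarrow> complex" where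
  "combined_integral M f = (\<Sum>k<4. \<i> ^ k * (\<integral>u. f u \<partial>M k))"

lemma sets_variation_part [measurable_cong]: "sets (variation_part X \<mu> k) = sets (restrict_space borel X)"
  by (simp add: variation_part_def sets_borel_measure_on)

lemma space_variation_part: "space (variation_part X \<mu> k) = X"
  by (simp add: variation_part_def space_borel_measure_on)

text \<open>No integrability is required: a non-integrable part contributes the default value 0 on
  both sides.\<close>

lemma measure_integral_eq_combined:
  "measure_integral X \<mu> f = combined_integral (variation_part X \<mu>) (\<lambda>u. complex_of_real (f u))"
  by (simp add: measure_integral_def signed_integral_def combined_integral_def variation_part_def
      eval_nat_numeral complex_eq_iff)

lemma emeasure_variation_part_le:
  assumes "bounded_additive X \<mu>" "X \<in> sets borel"
  shows "emeasure (variation_part X \<mu> k) A \<le> total_variation \<mu> A"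
proof (cases "A \<in> sets (restrict_space borel X)")
  case True
  have "Re (z / \<i> ^ k) \<le> cmod z" for z
    using complex_Re_le_cmod[of "z / \<i> ^ k"] by (simp add: norm_divide norm_power)
  then show ?thesis
    using assms True
    by (subst emeasure_variation_part) (auto simp: sets_restrict_borel intro: positive_variation_le_total_variation)
next
  case False
  then show ?thesis
    by (simp add: emeasure_notin_sets sets_variation_part)
qed

text \<open>Domination set by set gives domination of integrals. It carries the finiteness of
  \<open>V_norm\<close>, a statement on the total variation, over to each of the four parts.\<close>

lemma nn_integral_variation_part_le:
  assumes \<mu>: "bounded_additive X \<mu>" and X: "X \<in> sets borel"
  shows "(\<integral>\<^sup>+u. f u \<partial>variation_part X \<mu> k) \<le> (\<integral>\<^sup>+u. f u \<partial>variation_measure X \<mu>)"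
proof (rule nn_integral_mono_measure)
  show sets: "sets (variation_part X \<mu> k) = sets (variation_measure X \<mu>)"
    by (simp add: variation_measure_def sets_variation_part sets_borel_measure_on)
  show "variation_part X \<mu> k \<le> variation_measure X \<mu>"
  proof (subst le_measure[OF sets], rule ballI)
    fix A assume "A \<in> sets (variation_part X \<mu> k)"
    then have "emeasure (variation_measure X \<mu>) A = total_variation \<mu> A"
      unfolding variation_measure_def sets_variation_part using \<mu> X
      by (intro emeasure_borel_measure_on countably_additive_total_variation
          total_variation_empty bounded_additive_empty)
    then show "emeasure (variation_part X \<mu> k) A \<le> emeasure (variation_measure X \<mu>) A"
      using emeasure_variation_part_le[OF assms] by simp
  qed
qed

section \<open>Reflection and the even extension\<close>

lemma uminus_image_borel: "A \<in> sets borel \<Longrightarrow> uminus ` A \<in> sets borel" for A :: "real set"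
proof -
  assume A: "A \<in> sets borel"
  have "uminus ` A = uminus -` A"
    by force
  then show ?thesis
    using measurable_sets[OF borel_measurable_uminus[OF measurable_ident] A] by (simp add: space_borel)
qed

lemma abs_vimage_borel: "A \<in> sets borel \<Longrightarrow> abs -` A \<in> sets borel" for A :: "real set"
  using measurable_sets[of abs borel borel A] by simp

lemma bounded_uminus_image: "bounded (uminus ` A) \<longleftrightarrow> bounded A" for A :: "real set"
  by (auto simp: bounded_iff)

lemma bounded_additive_even_extension:
  assumes \<mu>: "bounded_additive {0..} \<mu>"
  shows "bounded_additive UNIV (even_extension \<mu>)"
  unfolding bounded_additive_def
proof (intro allI impI)
  fix A :: "nat \<Rightarrow> real set"
  assume A: "disjoint_family A" "range A \<subseteq> bounded_borel UNIV" "bounded (\<Union>i. A i)"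
  have *: "(\<lambda>i. \<mu> (B i \<inter> {0..})) sums \<mu> ((\<Union>i. B i) \<inter> {0..})"
    if B: "disjoint_family B" "\<And>i. B i \<in> sets borel" "bounded (\<Union>i. B i)" for B :: "nat \<Rightarrow> real set"
  proof -
    have "(\<Union>i. B i) \<inter> {0..} \<in> bounded_borel {0..}"
      using B by (auto simp: bounded_borel_def intro: bounded_subset)
    then have "(\<lambda>i. \<mu> ((\<Union>i. B i) \<inter> {0..} \<inter> B i)) sums \<mu> ((\<Union>i. B i) \<inter> {0..})"
      using B by (intro bounded_additive_sums[OF \<mu>]) auto
    moreover have "(\<Union>i. B i) \<inter> {0..} \<inter> B i = B i \<inter> {0..}" for i
      by blast
    ultimately show ?thesis
      by simp
  qed
  have "(\<lambda>i. \<mu> (A i \<inter> {0..})) sums \<mu> ((\<Union>i. A i) \<inter> {0..})"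
    using A by (intro *) (auto simp: bounded_borel_def)
  moreover have "(\<lambda>i. \<mu> (uminus ` A i \<inter> {0..})) sums \<mu> ((\<Union>i. uminus ` A i) \<inter> {0..})"
  proof (rule *)
    show "disjoint_family (\<lambda>i. uminus ` A i)"
      using A(1) by (auto simp: disjoint_family_on_def) (metis disjoint_iff)
    have "bounded (uminus ` (\<Union>i. A i))"
      using A(3) bounded_uminus_image by blast
    then show "bounded (\<Union>i. uminus ` A i)"
      by (simp only: image_UN)
  qed (use A(2) in \<open>auto simp: bounded_borel_def intro: uminus_image_borel\<close>)
  ultimately show "(\<lambda>i. even_extension \<mu> (A i)) sums even_extension \<mu> (\<Union>i. A i)"
    unfolding even_extension_def image_UN by (rule sums_add)
qed

lemma positive_variation_even_extension:
  assumes B: "B \<in> sets borel" "B \<subseteq> {0..}"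
  shows "positive_variation (\<lambda>A. Re (even_extension \<mu> A / \<i> ^ k)) (abs -` B)
    = 2 * positive_variation (\<lambda>A. Re (\<mu> A / \<i> ^ k)) B"
    (is "positive_variation ?e _ = 2 * positive_variation ?\<sigma> B")
proof (rule antisym)
  have e: "?e A = ?\<sigma> (A \<inter> {0..}) + ?\<sigma> (uminus ` A \<inter> {0..})" for A
    by (simp add: even_extension_def add_divide_distrib)
  show "positive_variation ?e (abs -` B) \<le> 2 * positive_variation ?\<sigma> B"
    unfolding positive_variation_def[of ?e]
  proof (rule SUP_least)
    fix A assume A: "A \<in> bounded_borel (abs -` B)"
    have "A \<inter> {0..} \<in> bounded_borel B"
      using A by (auto simp: bounded_borel_def intro: bounded_subset)
    then have 1: "ennreal (?\<sigma> (A \<inter> {0..})) \<le> positive_variation ?\<sigma> B"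
      unfolding positive_variation_def by (rule SUP_upper)
    have "uminus ` A \<inter> {0..} \<in> bounded_borel B"
      using A uminus_image_borel bounded_uminus_image[of A]
      by (auto simp: bounded_borel_def intro: bounded_subset)
    then have 2: "ennreal (?\<sigma> (uminus ` A \<inter> {0..})) \<le> positive_variation ?\<sigma> B"
      unfolding positive_variation_def by (rule SUP_upper)
    have "ennreal (?e A) \<le> ennreal (?\<sigma> (A \<inter> {0..})) + ennreal (?\<sigma> (uminus ` A \<inter> {0..}))"
      unfolding e by (rule ennreal_add_le)
    also have "\<dots> \<le> 2 * positive_variation ?\<sigma> B"
      using add_mono[OF 1 2] by (simp add: mult_2)
    finally show "ennreal (?e A) \<le> 2 * positive_variation ?\<sigma> B" .
  qed
  show "2 * positive_variation ?\<sigma> B \<le> positive_variation ?e (abs -` B)"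
    unfolding positive_variation_def[of ?\<sigma>] SUP_mult_left_ennreal
  proof (rule SUP_least)
    fix A assume A: "A \<in> bounded_borel B"
    have "A \<subseteq> {0..}"
      using A B by (auto simp: bounded_borel_def)
    then have "abs -` A \<inter> {0..} = A"
      by (auto simp: subset_iff)
    moreover have "uminus ` (abs -` A) = abs -` A"
      using image_eqI[of x uminus "- x" "abs -` A" for x] by auto
    ultimately have "?e (abs -` A) = 2 * ?\<sigma> A"
      unfolding e by simp
    then have "2 * ennreal (?\<sigma> A) = ennreal (?e (abs -` A))"
      by (cases "?\<sigma> A \<ge> 0") (auto simp: ennreal_mult' ennreal_neg)
    moreover have "abs -` A \<in> bounded_borel (abs -` B)"
      using A by (fastforce simp: bounded_borel_def bounded_iff intro: abs_vimage_borel)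
    ultimately show "2 * ennreal (?\<sigma> A) \<le> positive_variation ?e (abs -` B)"
      unfolding positive_variation_def[of ?e] by (metis (no_types, lifting) SUP_upper)
  qed
qed

text \<open>Each part of the extension is pushed forward by \<open>abs\<close> to twice the
  corresponding part on the half line. Nonnegativity of \<open>f\<close> allows the comparison to
  run through nonnegative integrals, so integrability is not an issue.\<close>

lemma measure_integral_even_extension:
  assumes \<mu>: "bounded_additive {0..} \<mu>" and [measurable]: "f \<in> borel_measurable borel"
    and even: "\<And>u. f (- u) = f u" and nonneg: "\<And>u. 0 \<le> f u"
  shows "measure_integral UNIV (even_extension \<mu>) f = 2 * measure_integral {0..} \<mu> f"
proof -
  have eq: "(\<integral>u. complex_of_real (f u) \<partial>variation_part UNIV (even_extension \<mu>) k)
      = 2 * (\<integral>u. complex_of_real (f u) \<partial>variation_part {0..} \<mu> k)" for k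
  proof -
    let ?E = "variation_part UNIV (even_extension \<mu>) k" and ?M = "variation_part {0..} \<mu> k"
    have [measurable_cong]: "sets ?E = sets borel"
      by (simp add: sets_variation_part)
    have abs_meas: "abs \<in> measurable ?E (restrict_space borel {0..})"
      by (rule measurable_restrict_space2) auto
    have fE [measurable]: "f \<in> borel_measurable ?E" and fM [measurable]: "f \<in> borel_measurable ?M"
      and fR [measurable]: "f \<in> borel_measurable (restrict_space borel {0..})"
      using measurable_restrict_space1[OF assms(2)] by (auto cong: measurable_cong_sets simp: sets_variation_part)
    have "distr ?E (restrict_space borel {0..}) abs = scale_measure 2 ?M"
    proof (rule measure_eqI)
      fix A assume "A \<in> sets (distr ?E (restrict_space borel {0..}) abs)"
      then have A: "A \<in> sets borel" "A \<subseteq> {0..}"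
        by (auto simp: sets_restrict_borel)
      have "emeasure (distr ?E (restrict_space borel {0..}) abs) A = emeasure ?E (abs -` A)"
        using A by (subst emeasure_distr[OF abs_meas]) (auto simp: sets_restrict_borel space_variation_part)
      also have "\<dots> = positive_variation (\<lambda>A. Re (even_extension \<mu> A / \<i> ^ k)) (abs -` A)"
        using A by (intro emeasure_variation_part bounded_additive_even_extension \<mu> abs_vimage_borel) auto
      also have "\<dots> = 2 * positive_variation (\<lambda>A. Re (\<mu> A / \<i> ^ k)) A"
        by (rule positive_variation_even_extension[OF A])
      also have "\<dots> = 2 * emeasure ?M A"
        using A by (subst emeasure_variation_part[OF \<mu>]) auto
      finally show "emeasure (distr ?E (restrict_space borel {0..}) abs) A = emeasure (scale_measure 2 ?M) A"
        by simp
    qed (simp add: sets_variation_part)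
    then have "(\<integral>\<^sup>+u. f u \<partial>distr ?E (restrict_space borel {0..}) abs) = 2 * (\<integral>\<^sup>+u. f u \<partial>?M)"
      by (simp add: nn_integral_scale_measure)
    moreover have "(\<integral>\<^sup>+u. f u \<partial>distr ?E (restrict_space borel {0..}) abs) = (\<integral>\<^sup>+u. f \<bar>u\<bar> \<partial>?E)"
      by (rule nn_integral_distr[OF abs_meas]) simp
    moreover have "f \<bar>u\<bar> = f u" for u
      using even by (simp add: abs_if)
    ultimately have "(\<integral>\<^sup>+u. f u \<partial>?E) = 2 * (\<integral>\<^sup>+u. f u \<partial>?M)"
      by simp
    then have "(\<integral>u. f u \<partial>?E) = 2 * (\<integral>u. f u \<partial>?M)"
      using nonneg by (subst (1 2) integral_eq_nn_integral) (auto simp: enn2real_mult)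
    then show ?thesis
      by simp
  qed
  show ?thesis
    unfolding measure_integral_eq_combined combined_integral_def eq
    by (simp add: sum_distrib_left mult_ac)
qed

section \<open>Phragmen-Lindelof principles\<close>

text \<open>Cut \<open>S\<close> with a ball of radius \<open>max R (cmod z)\<close>: it contains
  \<open>z\<close>, and each frontier point of the intersection lies either on the frontier of
  \<open>S\<close> or on the sphere, where \<open>far\<close> applies.\<close>

lemma maximum_modulus_unbounded:
  fixes f :: "complex \<Rightarrow> complex"
  assumes "closed S" "f holomorphic_on interior S" "continuous_on S f"
    and frontier: "\<And>z. z \<in> frontier S \<Longrightarrow> cmod (f z) \<le> B"
    and far: "\<And>z. z \<in> S \<Longrightarrow> R \<le> cmod z \<Longrightarrow> cmod (f z) \<le> B"
    and "z \<in> S"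
  shows "cmod (f z) \<le> B"
proof -
  define T where "T = S \<inter> cball 0 (max R (cmod z))"
  show ?thesis
  proof (rule maximum_modulus_frontier[of f T])
    show "f holomorphic_on interior T"
      using assms(2) by (rule holomorphic_on_subset) (auto simp: T_def intro: interior_mono[THEN subsetD])
    have "closed T"
      unfolding T_def using assms(1) by (intro closed_Int) auto
    then show "continuous_on (closure T) f"
      using assms(3) by (auto simp: T_def intro: continuous_on_subset)
    show "bounded T"
      by (auto simp: T_def)
    show "cmod (f w) \<le> B" if w: "w \<in> frontier T" for w
    proof -
      have "w \<in> S"
        using w \<open>closed T\<close> frontier_subset_closed[of T] by (auto simp: T_def)
      moreover have "w \<in> frontier S \<or> cmod w = max R (cmod z)"
        using w frontier_Int_subset[of S "cball 0 (max R (cmod z))"] by (auto simp: T_def)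
      ultimately show ?thesis
        using frontier far by auto
    qed
    show "z \<in> T"
      using assms(6) by (simp add: T_def)
  qed
qed

text \<open>Removes an auxiliary factor by letting \<epsilon> tend to 0 from the right at a fixed
  point.\<close>

lemma le_of_le_mult_exp_small:
  fixes a B t :: real
  assumes "\<And>\<epsilon>. \<epsilon> > 0 \<Longrightarrow> a \<le> B * exp (\<epsilon> * t)"
  shows "a \<le> B"
proof -
  have "((\<lambda>\<epsilon>. B * exp (\<epsilon> * t)) \<longlongrightarrow> B * exp (0 * t)) (at_right 0)"
    by (intro tendsto_intros)
  then show ?thesis
    using assms tendsto_lowerbound[of "\<lambda>\<epsilon>. B * exp (\<epsilon> * t)" "B * exp (0 * t)" "at_right 0" a]
    by (simp add: eventually_at_filter)
qed

text \<open>The hypotheses say that s^2 has argument at most pi/4 in modulus, so s^3 has argument at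
  most 3 pi/8, which is bounded away from pi/2. The proof avoids angles and uses the slightly weaker
  slope bound 2|Im s| \<le> Re s.\<close>

lemma Re_power3_ge:
  assumes "0 \<le> Re s" "\<bar>Im (s\<^sup>2)\<bar> \<le> Re (s\<^sup>2)"
  shows "cmod s ^ 3 \<le> 8 * Re (s ^ 3)"
proof -
  define p q where "p = Re s" and "q = Im s"
  have p: "p \<ge> 0"
    using assms by (simp add: p_def)
  have re: "Re (s\<^sup>2) = p\<^sup>2 - q\<^sup>2" and im: "Im (s\<^sup>2) = 2 * p * q"
    by (simp_all add: p_def q_def power2_eq_square)
  have q: "2 * \<bar>q\<bar> \<le> p"
  proof (rule ccontr)
    assume *: "\<not> 2 * \<bar>q\<bar> \<le> p"
    then have "p * p \<le> p * (2 * \<bar>q\<bar>)"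
      using p by (intro mult_left_mono) auto
    moreover have "2 * p * \<bar>q\<bar> \<le> p\<^sup>2 - q\<^sup>2"
      using assms p by (simp add: re im abs_mult)
    ultimately have "q\<^sup>2 \<le> 0"
      by (simp add: power2_eq_square)
    then show False
      using * p by simp
  qed
  then have qq: "4 * q\<^sup>2 \<le> p\<^sup>2"
    using power_mono[OF q, of 2] by (simp add: power_mult_distrib)
  have "cmod s \<le> 5 / 4 * p"
    unfolding cmod_def p_def[symmetric] q_def[symmetric]
  proof (rule real_le_lsqrt)
    have "16 * q\<^sup>2 \<le> 9 * p\<^sup>2"
      using qq zero_le_power2[of p] by linarith
    then show "p\<^sup>2 + q\<^sup>2 \<le> (5 / 4 * p)\<^sup>2"
      by (simp add: power_mult_distrib power_divide)
  qed (use p in simp)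
  then have "cmod s ^ 3 \<le> (5 / 4 * p) ^ 3"
    by (rule power_mono) simp
  also have "\<dots> \<le> 8 * (p * (p\<^sup>2 / 4))"
    using p by (simp add: power3_eq_cube power2_eq_square)
  also have "p * (p\<^sup>2 / 4) \<le> p * (p\<^sup>2 - 3 * q\<^sup>2)"
    using qq p by (intro mult_left_mono) auto
  also have "p * (p\<^sup>2 - 3 * q\<^sup>2) = Re (s ^ 3)"
    by (simp add: power3_eq_cube power2_eq_square p_def q_def algebra_simps)
  finally show ?thesis
    by simp
qed

text \<open>The comparison factor exp(-\<epsilon> s^3) has order 3/2 in w. This exceeds the order 1
  of the allowed growth and stays below the critical order 2 of a quadrant, so the factor beats
  exp(\<rho>|w|) and still has modulus at most 1 throughout the quadrant.\<close>

lemma phragmen_lindelof_quadrant: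
  fixes f :: "complex \<Rightarrow> complex"
  assumes \<sigma>: "\<sigma> = 1 \<or> \<sigma> = -1"
    and S: "S = {w. 0 \<le> Re w \<and> 0 \<le> \<sigma> * Im w}"
    and hol: "f holomorphic_on interior S" and cont: "continuous_on S f"
    and axes: "\<And>w. w \<in> S \<Longrightarrow> Re w = 0 \<or> Im w = 0 \<Longrightarrow> cmod (f w) \<le> B"
    and growth: "\<And>w. w \<in> S \<Longrightarrow> cmod (f w) \<le> B * exp (\<rho> * cmod w)"
    and \<rho>: "0 \<le> \<rho>" and w: "w \<in> S"
  shows "cmod (f w) \<le> B"
proof -
  \<comment> \<open>Multiplication by 1 - i \<sigma> turns the quadrant into the sector |arg| \<le>
    pi/4 (and scales by sqrt 2). Adding 1 keeps the argument of the square root off the branch cut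
    even at w = 0.\<close>
  define s where "s w = csqrt (w * Complex 1 (- \<sigma>) + 1)" for w
  have "0 \<in> S"
    by (simp add: S)
  then have B: "0 \<le> B"
    using axes[of 0] norm_ge_zero[of "f 0"] by (simp del: norm_ge_zero)
  have s2: "(s w)\<^sup>2 = w * Complex 1 (- \<sigma>) + 1" for w
    by (simp add: s_def)
  have re: "Re ((s w)\<^sup>2) = Re w + \<sigma> * Im w + 1" and im: "Im ((s w)\<^sup>2) = Im w - \<sigma> * Re w" for w
    by (simp_all add: s2)
  have s0: "0 \<le> Re (s w)" for w
    using csqrt_principal[of "w * Complex 1 (- \<sigma>) + 1"] by (auto simp: s_def simp del: csqrt.simps)
  have cube: "cmod (s w) ^ 3 \<le> 8 * Re (s w ^ 3)" and large: "cmod w \<le> cmod (s w) ^ 2" if "w \<in> S" for w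
  proof -
    show "cmod (s w) ^ 3 \<le> 8 * Re (s w ^ 3)"
      using that \<sigma> by (intro Re_power3_ge s0) (auto simp only: re im S mem_Collect_eq)
    have "cmod w \<le> \<bar>Re w\<bar> + \<bar>Im w\<bar>"
      by (rule cmod_le)
    also have "\<dots> \<le> Re ((s w)\<^sup>2)"
      using that \<sigma> by (auto simp: re S)
    also have "\<dots> \<le> cmod (s w) ^ 2"
      by (metis complex_Re_le_cmod norm_power)
    finally show "cmod w \<le> cmod (s w) ^ 2" .
  qed
  have arg: "w * Complex 1 (- \<sigma>) + 1 \<notin> \<real>\<^sub>\<le>\<^sub>0" if "w \<in> S" for w
    using that \<sigma> by (auto simp: S complex_nonpos_Reals_iff)
  have "closed S"
    unfolding S by (intro closed_Collect_conj closed_Collect_le continuous_intros)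
  have "{w. 0 < Re w \<and> 0 < \<sigma> * Im w} \<subseteq> interior S"
    unfolding S by (rule interior_maximal) (auto intro!: open_Collect_conj open_Collect_less continuous_intros)
  then have frontier: "w \<in> S \<and> (Re w = 0 \<or> Im w = 0)" if "w \<in> frontier S" for w
    using that \<open>closed S\<close> \<sigma> by (auto simp: frontier_def S subset_iff order_less_le)
  have "cmod (f w) \<le> B * exp (\<epsilon> * Re (s w ^ 3))" if \<epsilon>: "\<epsilon> > 0" for \<epsilon>
  proof -
    define g where "g w = f w * exp (- (of_real \<epsilon> * s w ^ 3))" for w
    have g: "cmod (g w) = cmod (f w) * exp (- (\<epsilon> * Re (s w ^ 3)))" for w
      by (simp add: g_def norm_mult)
    have "cmod (g w) \<le> B"
    proof (rule maximum_modulus_unbounded[OF \<open>closed S\<close> _ _ _ _ w])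
      show "g holomorphic_on interior S"
        unfolding g_def s_def using arg interior_subset by (intro holomorphic_intros hol) blast
      show "continuous_on S g"
        unfolding g_def s_def using arg
        by (intro continuous_intros cont continuous_on_compose2[OF continuous_on_csqrt]) auto
      show "cmod (g z) \<le> B" if "z \<in> frontier S" for z
      proof -
        have z: "z \<in> S" "cmod (f z) \<le> B"
          using frontier[OF that] axes by auto
        have "0 \<le> Re (s z ^ 3)"
          using cube[OF z(1)] zero_le_power[OF norm_ge_zero, of "s z" 3] by linarith
        then have "cmod (g z) \<le> B * 1"
          unfolding g using z \<epsilon> B by (intro mult_mono) auto
        then show ?thesis
          by simp
      qed
      \<comment> \<open>Since |s|^2 \<ge> |z|, beyond this radius |s| \<ge> 8\<rho>/\<epsilon>, and
        hence \<epsilon> Re(s^3) \<ge> \<epsilon>|s|^3/8 \<ge> \<rho>|s|^2 \<ge> \<rho>|z|.\<close>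
      show "cmod (g z) \<le> B" if z: "z \<in> S" "(8 * \<rho> / \<epsilon>)\<^sup>2 \<le> cmod z" for z
      proof -
        have "8 * \<rho> / \<epsilon> \<le> cmod (s z)"
          using order_trans[OF z(2) large[OF z(1)]] by (rule power2_le_imp_le) simp
        then have "8 * \<rho> \<le> \<epsilon> * cmod (s z)"
          using \<epsilon> by (simp add: field_simps)
        then have "8 * \<rho> * cmod (s z) ^ 2 \<le> \<epsilon> * cmod (s z) * cmod (s z) ^ 2"
          by (rule mult_right_mono) simp
        also have "\<dots> = \<epsilon> * cmod (s z) ^ 3"
          by (simp add: power3_eq_cube power2_eq_square)
        also have "\<dots> \<le> \<epsilon> * (8 * Re (s z ^ 3))"
          using cube[OF z(1)] \<epsilon> by (intro mult_left_mono) auto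
        finally have "\<rho> * cmod (s z) ^ 2 \<le> \<epsilon> * Re (s z ^ 3)"
          by simp
        moreover have "\<rho> * cmod z \<le> \<rho> * cmod (s z) ^ 2"
          using large[OF z(1)] \<rho> by (intro mult_left_mono)
        ultimately have "exp (\<rho> * cmod z) * exp (- (\<epsilon> * Re (s z ^ 3))) \<le> 1"
          by (simp flip: exp_add)
        then have "B * (exp (\<rho> * cmod z) * exp (- (\<epsilon> * Re (s z ^ 3)))) \<le> B * 1"
          using B by (rule mult_left_mono)
        moreover have "cmod (g z) \<le> B * exp (\<rho> * cmod z) * exp (- (\<epsilon> * Re (s z ^ 3)))"
          unfolding g using growth[OF z(1)] by (intro mult_right_mono) auto
        ultimately show ?thesis
          by (simp add: mult.assoc)
      qed
    qed
    then show ?thesis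
      unfolding g by (simp add: exp_minus field_simps)
  qed
  then show ?thesis
    by (rule le_of_le_mult_exp_small)
qed

text \<open>As \<open>f\<close> is already known to be bounded, dividing by 1 + \<epsilon> w
  suffices: in the half plane this factor has modulus at least 1 and at least \<epsilon>|w|. The
  value of \<open>B\<close> only determines how far out the comparison starts, so it disappears from
  the conclusion.\<close>

lemma phragmen_lindelof_half_plane:
  fixes f :: "complex \<Rightarrow> complex"
  assumes hol: "f holomorphic_on {w. 0 < Re w}" and cont: "continuous_on {w. 0 \<le> Re w} f"
    and bounded: "\<And>w. 0 \<le> Re w \<Longrightarrow> cmod (f w) \<le> B"
    and axis: "\<And>w. Re w = 0 \<Longrightarrow> cmod (f w) \<le> M"
    and M: "0 < M" and w: "0 \<le> Re w"
  shows "cmod (f w) \<le> M"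
proof -
  have interior: "interior {w. 0 \<le> Re w} = {w. 0 < Re w}" and frontier: "frontier {w. 0 \<le> Re w} = {w. Re w = 0}"
    using interior_halfspace_ge[of "1::complex" 0] frontier_halfspace_ge[of "1::complex" 0]
    by (simp_all add: inner_complex_def)
  have "cmod (f w) \<le> M * exp (\<epsilon> * cmod w)" if \<epsilon>: "\<epsilon> > 0" for \<epsilon>
  proof -
    have ge1: "1 \<le> cmod (1 + of_real \<epsilon> * z)" and ge2: "\<epsilon> * cmod z \<le> cmod (1 + of_real \<epsilon> * z)" if "0 \<le> Re z" for z
    proof -
      have "0 \<le> \<epsilon> * Re z"
        using that \<epsilon> by simp
      then show "1 \<le> cmod (1 + of_real \<epsilon> * z)"
        using complex_Re_le_cmod[of "1 + of_real \<epsilon> * z"] by simp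
      have "\<epsilon> * cmod z = cmod (of_real \<epsilon> * z)"
        using \<epsilon> by (simp add: norm_mult)
      also have "\<dots> \<le> cmod (1 + of_real \<epsilon> * z)"
        using \<open>0 \<le> \<epsilon> * Re z\<close> by (simp add: cmod_def power_mono)
      finally show "\<epsilon> * cmod z \<le> cmod (1 + of_real \<epsilon> * z)" .
    qed
    have nz: "1 + of_real \<epsilon> * z \<noteq> 0" if "0 \<le> Re z" for z
      using ge1[OF that] by auto
    have "cmod (f w / (1 + of_real \<epsilon> * w)) \<le> M"
    proof (rule maximum_modulus_unbounded[of "{w. 0 \<le> Re w}" "\<lambda>w. f w / (1 + of_real \<epsilon> * w)"])
      show "closed {w. 0 \<le> Re w}"
        by (intro closed_Collect_le continuous_intros)
      show "(\<lambda>w. f w / (1 + of_real \<epsilon> * w)) holomorphic_on interior {w. 0 \<le> Re w}"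
        unfolding interior using nz by (intro holomorphic_intros hol) auto
      show "continuous_on {w. 0 \<le> Re w} (\<lambda>w. f w / (1 + of_real \<epsilon> * w))"
        using nz by (intro continuous_intros cont) auto
      show "cmod (f z / (1 + of_real \<epsilon> * z)) \<le> M" if "z \<in> frontier {w. 0 \<le> Re w}" for z
      proof -
        have z: "Re z = 0"
          using that by (simp add: frontier)
        have "cmod (f z) \<le> M * 1"
          using axis[OF z] by simp
        also have "\<dots> \<le> M * cmod (1 + of_real \<epsilon> * z)"
          using M ge1 z by (intro mult_left_mono) auto
        finally show ?thesis
          using nz[of z] z by (simp add: norm_divide divide_le_eq)
      qed
      show "cmod (f z / (1 + of_real \<epsilon> * z)) \<le> M" if "z \<in> {w. 0 \<le> Re w}" "B / (\<epsilon> * M) \<le> cmod z" for z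
      proof -
        have z: "0 \<le> Re z"
          using that by simp
        have "cmod (f z) \<le> B"
          using bounded z by simp
        also have "B \<le> M * (\<epsilon> * cmod z)"
          using that(2) \<epsilon> M by (simp add: divide_le_eq mult_ac)
        also have "\<dots> \<le> M * cmod (1 + of_real \<epsilon> * z)"
          using M ge2 z by (intro mult_left_mono) auto
        finally show ?thesis
          using nz[OF z] by (simp add: norm_divide divide_le_eq)
      qed
    qed (use w in auto)
    then have "cmod (f w) \<le> M * cmod (1 + of_real \<epsilon> * w)"
      using nz[OF w] by (simp add: norm_divide divide_le_eq)
    also have "\<dots> \<le> M * exp (\<epsilon> * cmod w)"
    proof (rule mult_left_mono)
      have "cmod (1 + of_real \<epsilon> * w) \<le> 1 + \<epsilon> * cmod w"
        using norm_triangle_ineq[of 1 "of_real \<epsilon> * w"] \<epsilon> by (simp add: norm_mult)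
      also have "\<dots> \<le> exp (\<epsilon> * cmod w)"
        by (rule exp_ge_add_one_self)
      finally show "cmod (1 + of_real \<epsilon> * w) \<le> exp (\<epsilon> * cmod w)" .
    qed (use M in simp)
    finally show ?thesis .
  qed
  then show ?thesis
    by (rule le_of_le_mult_exp_small)
qed

text \<open>Multiplication by exp(\<rho> w) leaves the modulus on the imaginary axis unchanged and
  cancels the decay on the real axis. The quadrant principle bounds the product by
  \<open>max M B\<close>; the half plane principle then needs the imaginary axis only and improves
  this to \<open>M\<close>. So the constant \<open>B\<close> of the real axis drops out.\<close>

lemma half_plane_exponential_decay:
  fixes g :: "complex \<Rightarrow> complex"
  assumes hol: "g holomorphic_on {w. 0 < Re w}" and cont: "continuous_on {w. 0 \<le> Re w} g"
    and bounded: "\<And>w. 0 \<le> Re w \<Longrightarrow> cmod (g w) \<le> M"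
    and axis: "\<And>x. 0 \<le> x \<Longrightarrow> cmod (g (of_real x)) \<le> B * exp (- (\<rho> * x))"
    and M: "0 < M" and \<rho>: "0 \<le> \<rho>" and w: "0 \<le> Re w"
  shows "cmod (g w) \<le> M * exp (- (\<rho> * Re w))"
proof -
  define f where "f w = g w * exp (of_real \<rho> * w)" for w
  have f: "cmod (f w) = cmod (g w) * exp (\<rho> * Re w)" for w
    by (simp add: f_def norm_mult)
  have hol_f: "f holomorphic_on {w. 0 < Re w}" and cont_f: "continuous_on {w. 0 \<le> Re w} f"
    unfolding f_def by (intro holomorphic_intros continuous_intros hol cont)+
  have "cmod (f w) \<le> max M B" if w: "0 \<le> Re w" for w
  proof -
    define \<sigma> :: real where "\<sigma> = (if Im w \<ge> 0 then 1 else -1)"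
    define S where "S = {w. 0 \<le> Re w \<and> 0 \<le> \<sigma> * Im w}"
    have S: "S \<subseteq> {w. 0 \<le> Re w}"
      by (auto simp: S_def)
    have "interior S \<subseteq> {w. 0 < Re w}"
      using interior_mono[OF S] interior_halfspace_ge[of "1::complex" 0]
      by (auto simp: inner_complex_def)
    show ?thesis
    proof (rule phragmen_lindelof_quadrant[of \<sigma> S f, OF _ S_def])
      show "f holomorphic_on interior S" "continuous_on S f"
        using hol_f cont_f S \<open>interior S \<subseteq> _\<close> holomorphic_on_subset continuous_on_subset by blast+
      show "cmod (f z) \<le> max M B" if z: "z \<in> S" "Re z = 0 \<or> Im z = 0" for z
      proof (cases "Re z = 0")
        case True
        then show ?thesis
          using bounded[of z] by (simp add: f)
      next
        case False
        then have "z = of_real (Re z)"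
          using z by (simp add: complex_eq_iff)
        then have "cmod (g z) \<le> B * exp (- (\<rho> * Re z))"
          using axis[of "Re z"] z S by auto
        then have "cmod (f z) \<le> B"
          by (simp add: f exp_minus field_simps)
        then show ?thesis
          by simp
      qed
      show "cmod (f z) \<le> max M B * exp (\<rho> * cmod z)" if z: "z \<in> S" for z
        unfolding f using bounded[of z] z S \<rho> complex_Re_le_cmod[of z] M
        by (intro mult_mono) (auto intro!: mult_left_mono)
    qed (use \<rho> w in \<open>auto simp: S_def \<sigma>_def\<close>)
  qed
  moreover have "cmod (f w) \<le> M" if "Re w = 0" for w
    using bounded[of w] that by (simp add: f)
  ultimately have "cmod (f w) \<le> M"
    by (rule phragmen_lindelof_half_plane[OF hol_f cont_f _ _ M w])
  then show ?thesis
    by (simp add: f exp_minus field_simps)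
qed

section \<open>Laplace inversion for truncated powers\<close>

lemma lebesgue_integral_inverse_sum_squares:
  fixes B :: real
  assumes B: "0 < B"
  shows "integrable lborel (\<lambda>y. 1 / (B\<^sup>2 + y\<^sup>2))" and "(\<integral>y. 1 / (B\<^sup>2 + y\<^sup>2) \<partial>lborel) = pi / B"
proof -
  let ?F = "\<lambda>y. arctan (y / B) / B"
  have pos: "0 < B\<^sup>2 + y\<^sup>2" for y
    using B by (simp add: add_pos_nonneg)
  have deriv: "(?F has_real_derivative 1 / (B\<^sup>2 + y\<^sup>2)) (at y)" for y
  proof -
    have "(?F has_real_derivative inverse (1 + (y / B)\<^sup>2) * (1 / B) / B) (at y)"
      using B by (auto intro!: derivative_eq_intros)
    moreover have "inverse (1 + (y / B)\<^sup>2) * (1 / B) / B = 1 / (B\<^sup>2 * (1 + (y / B)\<^sup>2))"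
      by (simp add: divide_inverse power2_eq_square mult_ac)
    moreover have "B\<^sup>2 * (1 + (y / B)\<^sup>2) = B\<^sup>2 + y\<^sup>2"
      using B by (simp add: distrib_left power_divide)
    ultimately show ?thesis
      by simp
  qed
  have cont: "isCont (\<lambda>y. 1 / (B\<^sup>2 + y\<^sup>2)) y" for y
    using pos[of y] by (intro continuous_intros) auto
  have bot: "((?F \<circ> real_of_ereal) \<longlongrightarrow> - pi / 2 / B) (at_right (-\<infinity>))"
    using B unfolding ereal_tendsto_simps by (real_asymp simp: field_simps)
  have top: "((?F \<circ> real_of_ereal) \<longlongrightarrow> pi / 2 / B) (at_left \<infinity>)"
    using B unfolding ereal_tendsto_simps by (real_asymp simp: field_simps)
  have "set_integrable lborel (einterval (-\<infinity>) \<infinity>) (\<lambda>y. 1 / (B\<^sup>2 + y\<^sup>2))"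
    "(LBINT y=-\<infinity>..\<infinity>. 1 / (B\<^sup>2 + y\<^sup>2)) = pi / 2 / B - (- pi / 2 / B)"
    using interval_integral_FTC_nonneg[OF _ deriv cont _ bot top] pos by (auto simp: less_imp_le)
  then show "integrable lborel (\<lambda>y. 1 / (B\<^sup>2 + y\<^sup>2))" "(\<integral>y. 1 / (B\<^sup>2 + y\<^sup>2) \<partial>lborel) = pi / B"
    by (simp_all add: set_integrable_def interval_lebesgue_integral_def set_lebesgue_integral_def)
qed

text \<open>The integrand of the Laplace inversion formula for \<open>\<tau>\<^sub>+\<^sup>S / S!\<close>, whose transform is \<open>1 / z\<^bsup>S + 1\<^esup>\<close>.\<close>

definition laplace_kernel :: "nat \<Rightarrow> real \<Rightarrow> complex \<Rightarrow> complex" where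
  "laplace_kernel S \<tau> z = exp (of_real \<tau> * z) / z ^ Suc S"

lemma norm_laplace_kernel: "cmod (laplace_kernel S \<tau> z) = exp (\<tau> * Re z) / cmod z ^ Suc S"
  by (simp add: laplace_kernel_def norm_divide norm_mult norm_power)

lemma continuous_on_laplace_kernel: "0 \<notin> A \<Longrightarrow> continuous_on A (laplace_kernel S \<tau>)"
  unfolding laplace_kernel_def by (intro continuous_intros) auto

text \<open>Of the S + 1 factors |z| in the denominator two are kept for integrability in y; the
  other S - 1 are at least a.\<close>

lemma norm_laplace_kernel_le:
  assumes "0 < a" "1 \<le> S"
  shows "cmod (laplace_kernel S \<tau> (Complex a y)) \<le> exp (\<tau> * a) / a ^ (S - 1) * (1 / (a\<^sup>2 + y\<^sup>2))"
proof -
  obtain T where S: "S = Suc T"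
    using assms by (cases S) auto
  have pos: "0 < a\<^sup>2 + y\<^sup>2"
    using assms by (simp add: add_pos_nonneg)
  have "a \<le> cmod (Complex a y)"
    using complex_Re_le_cmod[of "Complex a y"] by simp
  then have "a ^ T * (a\<^sup>2 + y\<^sup>2) \<le> cmod (Complex a y) ^ T * (cmod (Complex a y))\<^sup>2"
    using assms by (intro mult_mono power_mono) (auto simp: cmod_power2)
  also have "\<dots> = cmod (Complex a y) ^ Suc S"
    by (simp add: S power2_eq_square)
  finally have "1 / cmod (Complex a y) ^ Suc S \<le> 1 / (a ^ T * (a\<^sup>2 + y\<^sup>2))"
    using assms pos by (intro divide_left_mono) (auto simp: complex_eq_iff)
  then have "exp (\<tau> * a) * (1 / cmod (Complex a y) ^ Suc S) \<le> exp (\<tau> * a) * (1 / (a ^ T * (a\<^sup>2 + y\<^sup>2)))"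
    by (rule mult_left_mono) simp
  then show ?thesis
    by (simp add: norm_laplace_kernel S)
qed

lemma integrable_laplace_kernel:
  assumes "0 < a" "1 \<le> S"
  shows "integrable lborel (\<lambda>y. laplace_kernel S \<tau> (Complex a y))"
proof (rule Bochner_Integration.integrable_bound)
  show "integrable lborel (\<lambda>y. exp (\<tau> * a) / a ^ (S - 1) * (1 / (a\<^sup>2 + y\<^sup>2)))"
    by (rule integrable_mult_right) (rule lebesgue_integral_inverse_sum_squares(1)[OF assms(1)])
  have "continuous_on UNIV (\<lambda>y. laplace_kernel S \<tau> (Complex a y))"
    using assms by (intro continuous_on_compose2[OF continuous_on_laplace_kernel[of "- {0}"]] continuous_intros)
      (auto simp: complex_eq_iff)
  then show "(\<lambda>y. laplace_kernel S \<tau> (Complex a y)) \<in> borel_measurable lborel"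
    by (simp add: borel_measurable_continuous_onI)
  show "AE y in lborel. norm (laplace_kernel S \<tau> (Complex a y)) \<le> norm (exp (\<tau> * a) / a ^ (S - 1) * (1 / (a\<^sup>2 + y\<^sup>2)))"
    unfolding real_norm_def by (intro AE_I2 order_trans[OF norm_laplace_kernel_le[OF assms] abs_ge_self])
qed

lemma contour_integral_laplace_kernel_side:
  assumes "0 < T" and seg: "\<And>z. z \<in> closed_segment p q \<Longrightarrow> T \<le> cmod z \<and> \<tau> * Re z \<le> b"
  shows "cmod (contour_integral (linepath p q) (laplace_kernel S \<tau>)) \<le> exp b / T ^ Suc S * cmod (q - p)"
proof (rule contour_integral_bound_linepath)
  show "laplace_kernel S \<tau> contour_integrable_on linepath p q"
    using assms by (intro contour_integrable_continuous_linepath continuous_on_laplace_kernel) fastforce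
  show "cmod (laplace_kernel S \<tau> z) \<le> exp b / T ^ Suc S" if "z \<in> closed_segment p q" for z
    unfolding norm_laplace_kernel using seg[OF that] assms(1) by (intro frac_le power_mono) auto
qed (use assms in auto)

lemma contour_integral_rectpath:
  assumes "continuous_on (path_image (rectpath p q)) f" "Re p \<le> Re q" "Im p \<le> Im q"
  shows "contour_integral (rectpath p q) f =
    contour_integral (linepath p (Complex (Re q) (Im p))) f + contour_integral (linepath (Complex (Re q) (Im p)) q) f
    + contour_integral (linepath q (Complex (Re p) (Im q))) f + contour_integral (linepath (Complex (Re p) (Im q)) p) f"
proof -
  have "f contour_integrable_on linepath p (Complex (Re q) (Im p))"
    "f contour_integrable_on linepath (Complex (Re q) (Im p)) q"
    "f contour_integrable_on linepath q (Complex (Re p) (Im q))"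
    "f contour_integrable_on linepath (Complex (Re p) (Im q)) p"
    using assms(1) by (auto intro!: contour_integrable_continuous_linepath
        intro: continuous_on_subset simp: rectpath_def Let_def path_image_join)
  then show ?thesis
    by (simp add: rectpath_def Let_def)
qed

text \<open>The segment is closed to the left for \<tau> > 0, enclosing the pole at 0 with residue
  \<tau>^S / S!, and to the right otherwise, enclosing nothing. On each of the three other sides |z|
  \<ge> T, \<tau> Re z \<le> \<tau> a and the length is at most 2T, whence the 6.\<close>

lemma contour_integral_laplace_kernel_truncated:
  assumes a: "0 < a" and T: "1 \<le> T" "a \<le> T" and S: "1 \<le> S"
  shows "cmod (contour_integral (linepath (Complex a (- T)) (Complex a T)) (laplace_kernel S \<tau>)
      - 2 * pi * \<i> * of_real (if \<tau> > 0 then \<tau> ^ S / fact S else 0)) \<le> 6 * exp (\<tau> * a) / T"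
proof -
  let ?I = "\<lambda>p q. contour_integral (linepath p q) (laplace_kernel S \<tau>)"
  have T_pos: "0 < T"
    using T by simp
  have side: "cmod (?I p q) \<le> exp (\<tau> * a) / T ^ Suc S * (2 * T)"
    if "\<And>z. z \<in> closed_segment p q \<Longrightarrow> T \<le> cmod z \<and> \<tau> * Re z \<le> \<tau> * a" "cmod (q - p) \<le> 2 * T" for p q
  proof (rule order_trans[OF contour_integral_laplace_kernel_side[OF T_pos that(1)]])
    show "exp (\<tau> * a) / T ^ Suc S * cmod (q - p) \<le> exp (\<tau> * a) / T ^ Suc S * (2 * T)"
      using T_pos that(2) by (intro mult_left_mono) auto
  qed
  have final: "3 * (exp (\<tau> * a) / T ^ Suc S * (2 * T)) \<le> 6 * exp (\<tau> * a) / T"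
  proof -
    have "T ^ 1 \<le> T ^ S"
      using T S by (intro power_increasing) auto
    then have "6 * exp (\<tau> * a) / T ^ S \<le> 6 * exp (\<tau> * a) / T"
      using T_pos by (intro divide_left_mono) auto
    then show ?thesis
      using T_pos by (simp add: field_simps)
  qed
  have three: "3 * x = x + x + x" for x :: real
    by simp
  have vert: "closed_segment (Complex x y) (Complex x y') = {z. Re z = x \<and> y \<le> Im z \<and> Im z \<le> y'}" if "y \<le> y'" for x y y'
    using that by (auto simp: closed_segment_same_Re closed_segment_eq_real_ivl)
  have horiz: "closed_segment (Complex x y) (Complex x' y) = {z. Im z = y \<and> x \<le> Re z \<and> Re z \<le> x'}" if "x \<le> x'" for x x' y
    using that by (auto simp: closed_segment_same_Im closed_segment_eq_real_ivl)
  have Im_le: "T \<le> cmod z" if "\<bar>Im z\<bar> = T \<or> T \<le> \<bar>Re z\<bar>" for z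
    using that abs_Im_le_cmod[of z] abs_Re_le_cmod[of z] by auto
  show ?thesis
  proof (cases "\<tau> > 0")
    case True
    let ?p = "Complex (- T) (- T)" and ?q = "Complex a T"
    have zero: "0 \<in> box ?p ?q"
      using a T_pos by (simp add: in_box_complex_iff)
    then have image: "path_image (rectpath ?p ?q) \<subseteq> UNIV - {0}"
      using a T_pos path_image_rectpath_inter_box[of ?p ?q] by auto
    have "contour_integral (rectpath ?p ?q) (laplace_kernel S \<tau>)
        = 2 * pi * \<i> * (\<Sum>p\<in>{0}. winding_number (rectpath ?p ?q) p * residue (laplace_kernel S \<tau>) p)"
      using image
      by (intro Residue_theorem) (auto simp: laplace_kernel_def[abs_def] intro!: holomorphic_intros)
    moreover have "residue (laplace_kernel S \<tau>) 0 = of_real (\<tau> ^ S / fact S)"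
      using residue_fps_expansion_over_power_at_0[OF has_fps_expansion_exp[of "of_real \<tau> :: complex"], of S]
      by (simp add: laplace_kernel_def[abs_def])
    ultimately have "?I ?p (Complex a (- T)) + ?I (Complex a (- T)) ?q + ?I ?q (Complex (- T) T) + ?I (Complex (- T) T) ?p
        = 2 * pi * \<i> * of_real (\<tau> ^ S / fact S)"
      using winding_number_rectpath[OF zero] image a T_pos
      by (subst (asm) contour_integral_rectpath) (auto intro: continuous_on_laplace_kernel)
    then have "?I (Complex a (- T)) ?q - 2 * pi * \<i> * of_real (\<tau> ^ S / fact S)
        = - (?I ?p (Complex a (- T)) + ?I ?q (Complex (- T) T) + ?I (Complex (- T) T) ?p)"
      by algebra
    then have "cmod (?I (Complex a (- T)) ?q - 2 * pi * \<i> * of_real (\<tau> ^ S / fact S))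
        = cmod (?I ?p (Complex a (- T)) + ?I ?q (Complex (- T) T) + ?I (Complex (- T) T) ?p)"
      by (simp only: norm_minus_cancel)
    also have "\<dots> \<le> cmod (?I ?p (Complex a (- T))) + cmod (?I ?q (Complex (- T) T)) + cmod (?I (Complex (- T) T) ?p)"
      by (intro norm_triangle_le add_right_mono norm_triangle_ineq)
    also have "\<dots> \<le> 3 * (exp (\<tau> * a) / T ^ Suc S * (2 * T))"
    proof -
      have "cmod (?I ?p (Complex a (- T))) \<le> exp (\<tau> * a) / T ^ Suc S * (2 * T)"
        using a T True by (intro side) (auto simp: horiz Im_le cmod_def)
      moreover have "cmod (?I ?q (Complex (- T) T)) \<le> exp (\<tau> * a) / T ^ Suc S * (2 * T)"
        using a T True by (intro side) (auto simp: closed_segment_commute[of ?q] horiz Im_le cmod_def)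
      moreover have "cmod (?I (Complex (- T) T) ?p) \<le> exp (\<tau> * a) / T ^ Suc S * (2 * T)"
      proof (intro side conjI)
        fix z assume "z \<in> closed_segment (Complex (- T) T) ?p"
        then have z: "Re z = - T"
          using T_pos by (auto simp: closed_segment_commute[of "Complex (- T) T"] vert)
        then show "T \<le> cmod z"
          using T_pos by (intro Im_le) auto
        show "\<tau> * Re z \<le> \<tau> * a"
          using z a T_pos True by (intro mult_left_mono) auto
      next
        show "cmod (?p - Complex (- T) T) \<le> 2 * T"
          using T_pos by (simp add: complex_norm cmod_eq_Im)
      qed
      ultimately show ?thesis
        unfolding three by (intro add_mono)
    qed
    finally show ?thesis
      using final True by simp
  next
    case False
    let ?p = "Complex a (- T)" and ?q = "Complex (a + T) T"
    have image: "path_image (rectpath ?p ?q) \<subseteq> {z. 0 < Re z}"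
      using a T_pos path_image_rectpath_subset_cbox[of ?p ?q] by (auto simp: in_cbox_complex_iff)
    have "contour_integral (rectpath ?p ?q) (laplace_kernel S \<tau>) = 0"
      using image unfolding laplace_kernel_def
      by (intro contour_integral_unique Cauchy_theorem_convex_simple[of _ "{z. 0 < Re z}"])
        (auto intro!: holomorphic_intros convex_halfspace_Re_gt)
    then have "?I ?p (Complex (a + T) (- T)) + ?I (Complex (a + T) (- T)) ?q + ?I ?q (Complex a T) + ?I (Complex a T) ?p = 0"
      using image a T_pos
      by (subst (asm) contour_integral_rectpath) (auto intro!: continuous_on_laplace_kernel)
    moreover have "?I ?p (Complex a T) = - ?I (Complex a T) ?p"
      using a by (intro contour_integral_reverse_linepath continuous_on_laplace_kernel) (auto simp: closed_segment_same_Re)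
    ultimately have "?I ?p (Complex a T) = ?I ?p (Complex (a + T) (- T)) + ?I (Complex (a + T) (- T)) ?q + ?I ?q (Complex a T)"
      by algebra
    then have "cmod (?I ?p (Complex a T)) \<le>
        cmod (?I ?p (Complex (a + T) (- T))) + cmod (?I (Complex (a + T) (- T)) ?q) + cmod (?I ?q (Complex a T))"
      by (simp only:) (intro norm_triangle_le add_right_mono norm_triangle_ineq)
    also have "\<dots> \<le> 3 * (exp (\<tau> * a) / T ^ Suc S * (2 * T))"
    proof -
      have "cmod (?I ?p (Complex (a + T) (- T))) \<le> exp (\<tau> * a) / T ^ Suc S * (2 * T)"
        using a T False by (intro side) (auto simp: horiz Im_le cmod_def intro: mult_left_mono_neg)
      moreover have "cmod (?I (Complex (a + T) (- T)) ?q) \<le> exp (\<tau> * a) / T ^ Suc S * (2 * T)"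
      proof (intro side conjI)
        fix z assume "z \<in> closed_segment (Complex (a + T) (- T)) ?q"
        then have z: "Re z = a + T"
          using T_pos by (auto simp: vert)
        then show "T \<le> cmod z"
          using a by (intro Im_le) auto
        show "\<tau> * Re z \<le> \<tau> * a"
          using z a T_pos False by (intro mult_left_mono_neg) auto
      next
        show "cmod (?q - Complex (a + T) (- T)) \<le> 2 * T"
          using T_pos by (simp add: complex_norm cmod_eq_Im)
      qed
      moreover have "cmod (?I ?q (Complex a T)) \<le> exp (\<tau> * a) / T ^ Suc S * (2 * T)"
        using a T False by (intro side) (auto simp: closed_segment_commute[of ?q] horiz Im_le cmod_def intro: mult_left_mono_neg)
      ultimately show ?thesis
        unfolding three by (intro add_mono)
    qed
    finally show ?thesis
      using final False by simp
  qed
qed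

text \<open>The integrals over [-n, n] tend to the left side by dominated convergence and to the
  right side by the residue computation, whose error is O(1/n); the factors i come from dz = i
  dy.\<close>

lemma lebesgue_integral_laplace_kernel:
  assumes a: "0 < a" and S: "1 \<le> S"
  shows "(\<integral>y. laplace_kernel S \<tau> (Complex a y) \<partial>lborel) = 2 * pi * of_real (if \<tau> > 0 then \<tau> ^ S / fact S else 0)"
proof -
  let ?K = "\<lambda>y. laplace_kernel S \<tau> (Complex a y)"
  let ?J = "of_real (if \<tau> > 0 then \<tau> ^ S / fact S else 0) :: complex"
  let ?L = "\<lambda>n::nat. \<integral>y. indicator {- real n..real n} y *\<^sub>R ?K y \<partial>lborel"
  have "?L \<longlonglongrightarrow> (\<integral>y. ?K y \<partial>lborel)"
  proof (rule integral_dominated_convergence[where w = "\<lambda>y. norm (?K y)"])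
    note int = integrable_laplace_kernel[OF assms]
    show "integrable lborel (\<lambda>y. norm (?K y))"
      using int by simp
    show "?K \<in> borel_measurable lborel"
      by (rule borel_measurable_integrable[OF int])
    then show "(\<lambda>y. indicator {- real n..real n} y *\<^sub>R ?K y) \<in> borel_measurable lborel" for n
      by simp
    show "AE y in lborel. (\<lambda>n. indicator {- real n..real n} y *\<^sub>R ?K y) \<longlonglongrightarrow> ?K y"
    proof (rule AE_I2, rule tendsto_eventually)
      fix y :: real
      show "\<forall>\<^sub>F n in sequentially. indicator {- real n..real n} y *\<^sub>R ?K y = ?K y"
        using eventually_ge_at_top[of "nat \<lceil>\<bar>y\<bar>\<rceil>"] by eventually_elim (auto simp: indicator_def)
    qed
  qed (auto simp: indicator_def)
  then have "(\<lambda>n. \<i> * ?L n - 2 * pi * \<i> * ?J) \<longlonglongrightarrow> \<i> * (\<integral>y. ?K y \<partial>lborel) - 2 * pi * \<i> * ?J"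
    by (intro tendsto_intros)
  moreover have "(\<lambda>n. \<i> * ?L n - 2 * pi * \<i> * ?J) \<longlonglongrightarrow> 0"
  proof (rule Lim_null_comparison)
    show "(\<lambda>n. 6 * exp (\<tau> * a) / real n) \<longlonglongrightarrow> 0"
      by (rule lim_const_over_n)
    show "\<forall>\<^sub>F n in sequentially. norm (\<i> * ?L n - 2 * pi * \<i> * ?J) \<le> 6 * exp (\<tau> * a) / real n"
      using eventually_ge_at_top[of "nat \<lceil>max 1 a\<rceil>"]
    proof eventually_elim
      case (elim n)
      then have n: "1 \<le> real n" "a \<le> real n"
        by linarith+
      have "?L n = integral {- real n..real n} ?K"
        unfolding set_lebesgue_integral_def[symmetric]
        by (rule set_borel_integral_eq_integral(2))
          (auto simp: set_integrable_def intro!: integrable_mult_indicator integrable_laplace_kernel assms)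
      then have "\<i> * ?L n = contour_integral (linepath (Complex a (- real n)) (Complex a (real n))) (laplace_kernel S \<tau>)"
        using n by (subst contour_integral_linepath_same_Re[of _ a _ "- real n" "real n"]) auto
      then show ?case
        using contour_integral_laplace_kernel_truncated[OF a n S, of \<tau>] by (simp only:)
    qed
  qed
  ultimately have "\<i> * (\<integral>y. ?K y \<partial>lborel) - 2 * pi * \<i> * ?J = 0"
    by (rule LIMSEQ_unique)
  then have "\<i> * (\<integral>y. ?K y \<partial>lborel) = \<i> * (2 * pi * ?J)"
    by (simp add: mult_ac)
  then show ?thesis
    by simp
qed

section \<open>Gaussian transforms of measures of polynomial growth\<close>

text \<open>Arises from covering the half line by shells of width A \<ge> 1: the Gaussian is at most
  exp(-k) on shell k, and (k + 1) A + 2 \<le> (k + 3) A explains the 3.\<close>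

definition gauss_const :: "real \<Rightarrow> real" where
  "gauss_const Q = (\<Sum>k. exp (- real k) * (real k + 3) powr Q)"

lemma summable_gauss_const: "summable (\<lambda>k. exp (- real k) * (real k + 3) powr Q)"
proof (rule summable_comparison_test_bigo)
  have "summable (\<lambda>k. exp (- 1 / 2 :: real) ^ k)"
    by (rule summable_geometric) simp
  then show "summable (\<lambda>k. norm (exp (- real k / 2)))"
    by (simp add: exp_of_nat_mult[symmetric] mult.commute)
  show "(\<lambda>k. exp (- real k) * (real k + 3) powr Q) \<in> O(\<lambda>k. exp (- real k / 2))"
    by real_asymp
qed

lemma gauss_const_pos: "0 < gauss_const Q"
  unfolding gauss_const_def by (rule suminf_pos[OF summable_gauss_const]) simp

text \<open>Mean value inequality on the disc of radius |w|, where the derivative is at most exp |w|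
  in modulus.\<close>

lemma norm_exp_minus_one_le: "cmod (exp w - 1) \<le> cmod w * exp (cmod w)"
proof -
  have "cmod (exp w - exp 0) \<le> exp (cmod w) * cmod (w - 0)"
  proof (rule field_differentiable_bound[of "cball 0 (cmod w)" exp exp])
    show "cmod (exp z) \<le> exp (cmod w)" if "z \<in> cball 0 (cmod w)" for z
      using that complex_Re_le_cmod[of z] by simp
  qed (auto intro: DERIV_exp has_field_derivative_at_within)
  then show ?thesis
    by (simp add: mult.commute)
qed

lemma ennreal_le_suminf: "f k \<le> (\<Sum>k. f k)" for f :: "nat \<Rightarrow> ennreal"
  using sum_le_suminf[OF summableI, of "{k}" f] by simp

text \<open>Models a single positive part of \<mu>, with \<open>N\<close> in the role of the growth
  norm. Half-open intervals match \<open>growth_norm\<close>.\<close>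

locale growth_measure =
  fixes M :: "real measure" and Q N :: real
  assumes sets_M [measurable_cong]: "sets M = sets (restrict_space borel {0..})"
    and growth: "\<And>u. 0 \<le> u \<Longrightarrow> emeasure M {0..<u} \<le> ennreal (N * (u + 2) powr Q)"
    and Q: "0 \<le> Q" and N: "0 \<le> N"
begin

lemma space_M: "space M = {0..}"
  using sets_eq_imp_space_eq[OF sets_M] by (simp add: space_restrict_space)

lemma measurable_M [measurable]: "f \<in> borel_measurable borel \<Longrightarrow> f \<in> borel_measurable M"
  using measurable_restrict_space1 sets_M by (metis measurable_cong_sets)

lemma interval_sets [measurable]: "{0..<u} \<in> sets M"
  by (auto simp: sets_M sets_restrict_borel)

sublocale sigma_finite_measure M
proof
  show "\<exists>A. countable A \<and> A \<subseteq> sets M \<and> \<Union>A = space M \<and> (\<forall>a\<in>A. emeasure M a \<noteq> \<infinity>)"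
  proof (intro exI[of _ "range (\<lambda>n::nat. {0..<real n})"] conjI)
    show "\<Union>(range (\<lambda>n::nat. {0..<real n})) = space M"
      using reals_Archimedean2 by (auto simp: space_M)
    show "\<forall>a\<in>range (\<lambda>n::nat. {0..<real n}). emeasure M a \<noteq> \<infinity>"
    proof
      fix a assume "a \<in> range (\<lambda>n::nat. {0..<real n})"
      then obtain n where "a = {0..<real n}"
        by blast
      then have "emeasure M a \<le> ennreal (N * (real n + 2) powr Q)"
        using growth by simp
      then show "emeasure M a \<noteq> \<infinity>"
        by (auto simp: top_unique)
    qed
  qed auto
qed

text \<open>The natural width 1 / sqrt a of the Gaussian is enlarged to A = sqrt (1 + 1/a), so that
  A \<ge> 1 absorbs the summand 2 of the growth bound for every a. Since a A^2 = a + 1, on shell k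
  the exponent is at least (a + 1) k^2 \<ge> k.\<close>

lemma nn_integral_gauss_le:
  assumes a: "0 < a"
  shows "(\<integral>\<^sup>+u. ennreal (exp (- (a * u\<^sup>2))) \<partial>M) \<le> ennreal (gauss_const Q * N * (1 + 1 / a) powr (Q / 2))"
proof -
  define A where "A = sqrt (1 + 1 / a)"
  have A: "1 \<le> A" "a * A\<^sup>2 = a + 1" "A powr Q = (1 + 1 / a) powr (Q / 2)"
    using a by (simp_all add: A_def distrib_left) (simp flip: powr_half_sqrt add: powr_powr)
  have "ennreal (exp (- (a * u\<^sup>2))) \<le> (\<Sum>k. ennreal (exp (- real k)) * indicator {0..<(real k + 1) * A} u)"
    if "u \<in> space M" for u
  proof -
    define k where "k = nat \<lfloor>u / A\<rfloor>"
    have u: "0 \<le> u"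
      using that by (simp add: space_M)
    then have "0 \<le> u / A"
      using A by simp
    then have k: "real k \<le> u / A" "u / A < real k + 1"
      unfolding k_def by linarith+
    have "real k * A \<le> u"
      using k(1) A by (simp add: field_simps)
    then have "a * (real k * A)\<^sup>2 \<le> a * u\<^sup>2"
      using a A by (intro mult_left_mono power_mono) auto
    moreover have "a * (real k * A)\<^sup>2 = (a + 1) * (real k)\<^sup>2"
      using A(2) by (simp add: power_mult_distrib mult_ac)
    moreover have "real k \<le> 1 * (real k)\<^sup>2"
      by (cases k) (auto simp: power2_eq_square)
    moreover have "1 * (real k)\<^sup>2 \<le> (a + 1) * (real k)\<^sup>2"
      using a by (intro mult_right_mono) auto
    ultimately have "real k \<le> a * u\<^sup>2"
      by linarith
    then have "exp (- (a * u\<^sup>2)) \<le> exp (- real k)"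
      by simp
    moreover have "indicator {0..<(real k + 1) * A} u = (1 :: ennreal)"
      using k(2) u A by (simp add: field_simps)
    ultimately have "ennreal (exp (- (a * u\<^sup>2))) \<le> ennreal (exp (- real k)) * indicator {0..<(real k + 1) * A} u"
      by (simp add: ennreal_leI)
    also have "\<dots> \<le> (\<Sum>k. ennreal (exp (- real k)) * indicator {0..<(real k + 1) * A} u)"
      by (rule ennreal_le_suminf)
    finally show ?thesis .
  qed
  then have "(\<integral>\<^sup>+u. ennreal (exp (- (a * u\<^sup>2))) \<partial>M)
      \<le> (\<integral>\<^sup>+u. (\<Sum>k. ennreal (exp (- real k)) * indicator {0..<(real k + 1) * A} u) \<partial>M)"
    by (rule nn_integral_mono)
  also have "\<dots> = (\<Sum>k. \<integral>\<^sup>+u. ennreal (exp (- real k)) * indicator {0..<(real k + 1) * A} u \<partial>M)"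
    by (rule nn_integral_suminf) measurable
  also have "\<dots> = (\<Sum>k. ennreal (exp (- real k)) * emeasure M {0..<(real k + 1) * A})"
    by (simp add: nn_integral_cmult_indicator)
  also have "\<dots> \<le> (\<Sum>k. ennreal (N * (1 + 1 / a) powr (Q / 2) * (exp (- real k) * (real k + 3) powr Q)))"
  proof (intro suminf_le summableI)
    fix k
    have "(real k + 1) * A + 2 \<le> (real k + 3) * A"
      using A by (simp add: distrib_right)
    then have "((real k + 1) * A + 2) powr Q \<le> ((real k + 3) * A) powr Q"
      using A Q by (intro powr_mono2) auto
    also have "\<dots> = (1 + 1 / a) powr (Q / 2) * (real k + 3) powr Q"
      using A by (simp add: powr_mult)
    finally have le: "N * ((real k + 1) * A + 2) powr Q \<le> N * ((1 + 1 / a) powr (Q / 2) * (real k + 3) powr Q)"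
      using N by (rule mult_left_mono)
    have "emeasure M {0..<(real k + 1) * A} \<le> ennreal (N * ((1 + 1 / a) powr (Q / 2) * (real k + 3) powr Q))"
      using A by (intro order_trans[OF growth ennreal_leI[OF le]]) auto
    then have "ennreal (exp (- real k)) * emeasure M {0..<(real k + 1) * A}
        \<le> ennreal (exp (- real k)) * ennreal (N * ((1 + 1 / a) powr (Q / 2) * (real k + 3) powr Q))"
      by (rule mult_left_mono) simp
    then show "ennreal (exp (- real k)) * emeasure M {0..<(real k + 1) * A}
        \<le> ennreal (N * (1 + 1 / a) powr (Q / 2) * (exp (- real k) * (real k + 3) powr Q))"
      using N by (simp add: ennreal_mult'[symmetric] mult_ac)
  qed
  also have "\<dots> = ennreal (\<Sum>k. N * (1 + 1 / a) powr (Q / 2) * (exp (- real k) * (real k + 3) powr Q))"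
    using N by (intro suminf_ennreal2 summable_mult summable_gauss_const) auto
  also have "(\<Sum>k. N * (1 + 1 / a) powr (Q / 2) * (exp (- real k) * (real k + 3) powr Q))
      = gauss_const Q * N * (1 + 1 / a) powr (Q / 2)"
    unfolding gauss_const_def by (subst suminf_mult[OF summable_gauss_const]) (simp add: mult_ac)
  finally show ?thesis .
qed

lemma gauss_integrable: "0 < a \<Longrightarrow> integrable M (\<lambda>u. exp (- (a * u\<^sup>2)))"
  using nn_integral_gauss_le[of a] by (intro integrableI_bounded) (auto simp: le_less_trans)

lemma gauss_integral_le:
  assumes "0 < a"
  shows "(\<integral>u. exp (- (a * u\<^sup>2)) \<partial>M) \<le> gauss_const Q * N * (1 + 1 / a) powr (Q / 2)"
  using nn_integral_gauss_le[OF assms] N gauss_const_pos[of Q]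
  by (intro integral_real_bounded) auto

lemma norm_exp_gauss: "cmod (exp (- z * of_real (u\<^sup>2))) = exp (- (Re z * u\<^sup>2))"
  by simp

lemma exp_gauss_integrable:
  assumes "0 < Re z"
  shows "integrable M (\<lambda>u. exp (- z * of_real (u\<^sup>2)))"
proof (rule Bochner_Integration.integrable_bound[OF gauss_integrable[OF assms]])
  show "(\<lambda>u. exp (- z * of_real (u\<^sup>2))) \<in> borel_measurable M"
    by (intro measurable_M borel_measurable_continuous_onI continuous_intros)
qed (simp add: norm_exp_gauss)

lemma norm_exp_gauss_integral_le:
  assumes "0 < Re z"
  shows "cmod (\<integral>u. exp (- z * of_real (u\<^sup>2)) \<partial>M) \<le> gauss_const Q * N * (1 + 1 / Re z) powr (Q / 2)"
proof -
  have "cmod (\<integral>u. exp (- z * of_real (u\<^sup>2)) \<partial>M) \<le> (\<integral>u. cmod (exp (- z * of_real (u\<^sup>2))) \<partial>M)"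
    by (rule integral_norm_bound)
  also have "\<dots> \<le> gauss_const Q * N * (1 + 1 / Re z) powr (Q / 2)"
    unfolding norm_exp_gauss by (rule gauss_integral_le[OF assms])
  finally show ?thesis .
qed

lemma exp_gauss_integral_holomorphic:
  "(\<lambda>z. \<integral>u. exp (- z * of_real (u\<^sup>2)) \<partial>M) holomorphic_on {z. 0 < Re z}"
proof -
  have "((\<lambda>z. \<integral>u. exp (- z * of_real (u\<^sup>2)) \<partial>M) has_field_derivative
      (\<integral>u. - of_real (u\<^sup>2) * exp (- z * of_real (u\<^sup>2)) \<partial>M)) (at z)"
    if z: "0 < Re z" for z
  proof -
    define x where "x = Re z"
    have x: "0 < x"
      using z by (simp add: x_def)
    let ?e = "\<lambda>w u. exp (- w * of_real (u\<^sup>2)) :: complex"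
    have "((\<lambda>w. \<integral>u. ?e w u \<partial>M) has_field_derivative (\<integral>u. - of_real (u\<^sup>2) * ?e z u \<partial>M)) (at z within ball z (x / 4))"
      unfolding has_field_derivative_iff tendsto_at_iff_sequentially
    proof (intro allI impI)
      fix X assume X: "\<forall>i. X i \<in> ball z (x / 4) - {z}" and lim: "X \<longlonglongrightarrow> z"
      have near: "cmod (X i - z) < x / 4" "X i \<noteq> z" for i
        using X by (auto simp: dist_norm norm_minus_commute)
      have Re_X: "0 < Re (X i)" for i
        using near(1)[of i] abs_Re_le_cmod[of "X i - z"] x by (simp add: x_def)
      have "(\<lambda>i. \<integral>u. (?e (X i) u - ?e z u) / (X i - z) \<partial>M) \<longlonglongrightarrow> (\<integral>u. - of_real (u\<^sup>2) * ?e z u \<partial>M)"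
      \<comment> \<open>With |h| \<le> x/4 the difference quotient costs one factor exp(x u^2/4)
        from exp(-h u^2) - 1 and another one from u^2 \<le> (4/x) exp(x u^2/4); half of the decay
        exp(-x u^2) remains.\<close>
      proof (rule integral_dominated_convergence[where w = "\<lambda>u. 4 / x * exp (- (x / 2 * u\<^sup>2))"])
        show "(\<lambda>u. - of_real (u\<^sup>2) * ?e z u) \<in> borel_measurable M"
          by (intro measurable_M borel_measurable_continuous_onI continuous_intros)
        show "(\<lambda>u. (?e (X i) u - ?e z u) / (X i - z)) \<in> borel_measurable M" for i
          using near by (intro measurable_M borel_measurable_continuous_onI continuous_intros) auto
        show "integrable M (\<lambda>u. 4 / x * exp (- (x / 2 * u\<^sup>2)))"
          using x by (intro integrable_mult_right gauss_integrable) auto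
        show "AE u in M. (\<lambda>i. (?e (X i) u - ?e z u) / (X i - z)) \<longlonglongrightarrow> - of_real (u\<^sup>2) * ?e z u"
        proof (rule AE_I2)
          fix u
          have "((\<lambda>w. ?e w u) has_field_derivative - of_real (u\<^sup>2) * ?e z u) (at z within ball z (x / 4))"
            by (auto intro!: derivative_eq_intros)
          then show "(\<lambda>i. (?e (X i) u - ?e z u) / (X i - z)) \<longlonglongrightarrow> - of_real (u\<^sup>2) * ?e z u"
            unfolding has_field_derivative_iff tendsto_at_iff_sequentially o_def using X lim by blast
        qed
        show "AE u in M. norm ((?e (X i) u - ?e z u) / (X i - z)) \<le> 4 / x * exp (- (x / 2 * u\<^sup>2))" for i
        proof (rule AE_I2)
          fix u
          define h where "h = X i - z"
          have h: "cmod h \<le> x / 4" "h \<noteq> 0"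
            using near[of i] by (auto simp: h_def)
          have "?e (X i) u - ?e z u = ?e z u * (exp (- h * of_real (u\<^sup>2)) - 1)"
            by (simp add: h_def algebra_simps exp_diff exp_add exp_minus divide_inverse)
          then have "cmod (?e (X i) u - ?e z u) = exp (- (x * u\<^sup>2)) * cmod (exp (- h * of_real (u\<^sup>2)) - 1)"
            by (simp add: norm_mult x_def)
          also have "\<dots> \<le> exp (- (x * u\<^sup>2)) * (cmod h * u\<^sup>2 * exp (x / 4 * u\<^sup>2))"
          proof (intro mult_left_mono order_trans[OF norm_exp_minus_one_le])
            have "cmod (- h * of_real (u\<^sup>2)) = cmod h * u\<^sup>2"
              by (simp add: norm_mult norm_power)
            moreover have "exp (cmod h * u\<^sup>2) \<le> exp (x / 4 * u\<^sup>2)"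
              unfolding exp_le_cancel_iff using h(1) by (rule mult_right_mono) simp
            ultimately show "cmod (- h * of_real (u\<^sup>2)) * exp (cmod (- h * of_real (u\<^sup>2))) \<le> cmod h * u\<^sup>2 * exp (x / 4 * u\<^sup>2)"
              by (simp only:) (intro mult_left_mono, auto)
          qed simp
          also have "\<dots> \<le> exp (- (x * u\<^sup>2)) * (cmod h * (4 / x * exp (x / 4 * u\<^sup>2)) * exp (x / 4 * u\<^sup>2))"
          proof (intro mult_left_mono mult_right_mono)
            have "x / 4 * u\<^sup>2 \<le> exp (x / 4 * u\<^sup>2)"
              using exp_ge_add_one_self[of "x / 4 * u\<^sup>2"] by linarith
            then show "u\<^sup>2 \<le> 4 / x * exp (x / 4 * u\<^sup>2)"
              using x by (simp add: field_simps)
          qed auto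
          also have "\<dots> = cmod h * (4 / x) * (exp (- (x * u\<^sup>2)) * (exp (x / 4 * u\<^sup>2) * exp (x / 4 * u\<^sup>2)))"
            by (simp add: mult_ac)
          also have "exp (- (x * u\<^sup>2)) * (exp (x / 4 * u\<^sup>2) * exp (x / 4 * u\<^sup>2)) = exp (- (x / 2 * u\<^sup>2))"
            by (simp flip: exp_add)
          finally show "norm ((?e (X i) u - ?e z u) / (X i - z)) \<le> 4 / x * exp (- (x / 2 * u\<^sup>2))"
            using h by (simp add: norm_divide h_def[symmetric] field_simps)
        qed
      qed
      moreover have "(\<integral>u. (?e (X i) u - ?e z u) / (X i - z) \<partial>M) = ((\<integral>u. ?e (X i) u \<partial>M) - (\<integral>u. ?e z u \<partial>M)) / (X i - z)" for i
        by (simp only: integral_divide_zero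
            Bochner_Integration.integral_diff[OF exp_gauss_integrable[OF Re_X[of i]] exp_gauss_integrable[OF z]])
      ultimately show "((\<lambda>w. ((\<integral>u. ?e w u \<partial>M) - (\<integral>u. ?e z u \<partial>M)) / (w - z)) \<circ> X) \<longlonglongrightarrow> (\<integral>u. - of_real (u\<^sup>2) * ?e z u \<partial>M)"
        by (simp only: o_def)
    qed
    then show ?thesis
      using x by (simp add: at_within_open[of z "ball z (x / 4)"])
  qed
  then show ?thesis
    by (subst holomorphic_on_open) (auto simp: open_halfspace_Re_gt)
qed

lemma truncated_power_eq: "(if \<tau> > 0 then \<tau> ^ S / fact S else 0) = truncated_power S \<tau> / fact S"
  by (simp add: truncated_power_def)

text \<open>The kernel at \<tau> = X - u^2 factors as the kernel at X times exp(-z u^2). Its modulus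
  is a product of an integrable function of y and exp(-a u^2), so Fubini applies.\<close>

lemma truncated_power_integral_eq:
  assumes a: "0 < a" and S: "1 \<le> S"
  shows "integrable lborel (\<lambda>y. laplace_kernel S X (Complex a y) * (\<integral>u. exp (- Complex a y * of_real (u\<^sup>2)) \<partial>M))" (is ?int)
    and "(\<integral>u. of_real (truncated_power S (X - u\<^sup>2)) \<partial>M) = fact S / (2 * pi) *
      (\<integral>y. laplace_kernel S X (Complex a y) * (\<integral>u. exp (- Complex a y * of_real (u\<^sup>2)) \<partial>M) \<partial>lborel)" (is ?eq)
proof -
  interpret pair_sigma_finite M lborel ..
  have kernel: "laplace_kernel S (X - u\<^sup>2) z = laplace_kernel S X z * exp (- z * of_real (u\<^sup>2))" for u z
    by (simp add: laplace_kernel_def algebra_simps exp_diff exp_minus divide_inverse)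
  let ?f = "\<lambda>u y. laplace_kernel S X (Complex a y) * exp (- Complex a y * of_real (u\<^sup>2))"
  have int_f: "integrable (M \<Otimes>\<^sub>M lborel) (case_prod ?f)"
  proof (rule Fubini_integrable)
    show "(\<lambda>(u, y). ?f u y) \<in> borel_measurable (M \<Otimes>\<^sub>M lborel)"
      unfolding laplace_kernel_def Complex_eq by measurable
    show "integrable M (\<lambda>u. \<integral>y. norm (case (u, y) of (u, y) \<Rightarrow> ?f u y) \<partial>lborel)"
      using gauss_integrable[OF a] by (simp add: norm_mult)
    show "AE u in M. integrable lborel (\<lambda>y. case (u, y) of (u, y) \<Rightarrow> ?f u y)"
      using integrable_laplace_kernel[OF assms] unfolding kernel[symmetric] by simp
  qed
  have inner: "(\<integral>u. ?f u y \<partial>M) = laplace_kernel S X (Complex a y) * (\<integral>u. exp (- Complex a y * of_real (u\<^sup>2)) \<partial>M)" for y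
    by simp
  show ?int
    using integrable_snd[OF int_f] unfolding inner .
  have "(\<integral>u. of_real (truncated_power S (X - u\<^sup>2)) \<partial>M)
      = (\<integral>u. fact S / (2 * pi) * (\<integral>y. laplace_kernel S (X - u\<^sup>2) (Complex a y) \<partial>lborel) \<partial>M)"
    unfolding lebesgue_integral_laplace_kernel[OF assms] truncated_power_eq by simp
  also have "\<dots> = fact S / (2 * pi) * (\<integral>u. (\<integral>y. ?f u y \<partial>lborel) \<partial>M)"
    unfolding kernel by simp
  also have "(\<integral>u. (\<integral>y. ?f u y \<partial>lborel) \<partial>M) = (\<integral>y. (\<integral>u. ?f u y \<partial>M) \<partial>lborel)"
    by (rule Fubini_integral[OF int_f, symmetric])
  finally show ?eq
    unfolding inner .
qed

end

section \<open>Decay of the Laplace transform off the real axis\<close>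

lemma powr_le_exp:
  fixes v C \<kappa> :: real
  assumes "0 < v" "0 < C" "0 < \<kappa>"
  shows "v powr C \<le> (C / \<kappa>) powr C * exp (\<kappa> * v)"
proof -
  have "\<kappa> * v / C \<le> exp (\<kappa> * v / C)"
    using exp_ge_add_one_self[of "\<kappa> * v / C"] by linarith
  then have "v \<le> C / \<kappa> * exp (\<kappa> * v / C)"
    using assms by (simp add: field_simps)
  then have "v powr C \<le> (C / \<kappa> * exp (\<kappa> * v / C)) powr C"
    using assms by (intro powr_mono2) auto
  also have "\<dots> = (C / \<kappa>) powr C * exp (\<kappa> * v)"
    using assms by (subst powr_mult) (auto simp: exp_powr_real)
  finally show ?thesis .
qed

lemma power_le_fact_exp:
  fixes t :: real
  assumes "0 \<le> t"
  shows "t ^ k \<le> fact k * exp t"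
proof -
  have "(\<Sum>n\<in>{k}. t ^ n /\<^sub>R fact n) \<le> exp t"
    unfolding exp_def using assms by (intro sum_le_suminf summable_exp_generic) auto
  then show ?thesis
    by (simp add: field_simps)
qed

lemma Re_one_div: "Re (1 / z) = Re z / (cmod z)\<^sup>2"
  by (simp add: Re_divide cmod_power2)

text \<open>The Phragmen-Lindelof argument takes place in the variable \<open>w = 1/z\<close>.  The growth
  \<open>(1 + \<bar>w\<bar>\<^sup>2 / Re w)\<^bsup>Q/2\<^esup>\<close> is polynomial on \<open>Re w \<ge> d\<close>, where it is compensated by dividing by
  \<open>(1 + w / \<surd>d)\<^bsup>Q\<^esup>\<close>; taking \<open>d = Re w / 2\<close> loses only half of the decay.\<close>

lemma laplace_transform_decay:
  fixes L :: "complex \<Rightarrow> complex"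
  assumes hol: "L holomorphic_on {z. 0 < Re z}"
    and bound: "\<And>z. 0 < Re z \<Longrightarrow> cmod (L z) \<le> K * (1 + 1 / Re z) powr (Q / 2)"
    and real: "\<And>t. 0 < t \<Longrightarrow> t \<le> 1 \<Longrightarrow> cmod (L (of_real t)) \<le> c * t powr (- C) * exp (- \<rho> / t)"
    and K: "0 \<le> K" and Q: "0 \<le> Q" and c: "0 \<le> c" and C: "0 < C" and \<rho>: "0 < \<rho>" and z: "0 < Re z"
  shows "cmod (L z) \<le> 2 powr Q * K * (1 + 1 / Re z) powr (Q / 2) * exp (- (\<rho> / 2 * Re (1 / z)))"
proof (cases "K = 0")
  case True
  then show ?thesis
    using bound[OF z] by simp
next
  case False
  with K have K: "0 < K"
    by simp
  define w0 where "w0 = 1 / z"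
  define d where "d = Re w0 / 2"
  define b where "b = sqrt d"
  have "z \<noteq> 0"
    using z by auto
  then have d: "0 < d"
    using z by (simp add: d_def w0_def Re_one_div)
  then have b: "0 < b" "b\<^sup>2 = d"
    by (simp_all add: b_def)
  \<comment> \<open>As b^2 = d, on Re v \<ge> d one has |E v|^2 \<ge> 1 + |v|^2/d \<ge> 1 +
    1/Re(1/v), so the power Q of \<open>E\<close> cancels the growth of L(1/v). Re (E v) \<ge> 1
    keeps the principal power holomorphic. The shift by \<open>d\<close> in \<open>g\<close> moves
    the line Re v = d to the imaginary axis.\<close>
  define E where "E v = 1 + v / of_real b" for v :: complex
  define g where "g w = L (1 / (w + of_real d)) / E (w + of_real d) powr of_real Q" for w
  have Re_inv: "0 < Re (1 / v)" if "0 < Re v" for v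
  proof -
    have "v \<noteq> 0"
      using that by auto
    then show ?thesis
      using that by (simp add: Re_one_div)
  qed
  have Re_E: "1 \<le> Re (E v)" if "0 < Re v" for v
    using that b by (simp add: E_def)
  have E_pos: "E v \<notin> \<real>\<^sub>\<le>\<^sub>0" "1 \<le> cmod (E v)" "E v \<noteq> 0" if "0 < Re v" for v
    using Re_E[OF that] complex_Re_le_cmod[of "E v"] by (auto simp: complex_nonpos_Reals_iff)
  have norm_g: "cmod (g w) = cmod (L (1 / (w + of_real d))) / cmod (E (w + of_real d)) powr Q" if "0 \<le> Re w" for w
    using E_pos(3)[of "w + of_real d"] that d by (simp add: g_def norm_divide norm_powr_real_powr')
  have g_le: "cmod (g w) \<le> K" if w: "0 \<le> Re w" for w
  proof -
    define v where "v = w + of_real d"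
    have v: "d \<le> Re v" "0 < Re v"
      using w d by (auto simp: v_def)
    then have "v \<noteq> 0"
      by auto
    have "(cmod v)\<^sup>2 / Re v \<le> (cmod v)\<^sup>2 / d"
      using v d by (intro divide_left_mono) auto
    then have "1 + 1 / Re (1 / v) \<le> 1 + (cmod v)\<^sup>2 / d"
      using v d by (simp add: Re_one_div)
    also have "\<dots> \<le> (cmod (E v))\<^sup>2"
    proof -
      have "(cmod (E v))\<^sup>2 = (1 + Re v / b)\<^sup>2 + (Im v / b)\<^sup>2"
        by (simp add: E_def cmod_power2)
      also have "\<dots> = 1 + 2 * (Re v / b) + (cmod v)\<^sup>2 / d"
        unfolding b(2)[symmetric] cmod_power2 by (simp add: power2_eq_square algebra_simps add_divide_distrib)
      finally show ?thesis
        using v d b by simp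
    qed
    finally have "(1 + 1 / Re (1 / v)) powr (Q / 2) \<le> ((cmod (E v))\<^sup>2) powr (Q / 2)"
      using Q Re_inv[OF v(2)] by (intro powr_mono2) auto
    also have "\<dots> = cmod (E v) powr Q"
      using E_pos(3)[OF v(2)] by (simp flip: powr_numeral add: powr_powr)
    finally have "K * (1 + 1 / Re (1 / v)) powr (Q / 2) \<le> K * cmod (E v) powr Q"
      using K by simp
    then have "cmod (L (1 / v)) \<le> K * cmod (E v) powr Q"
      using bound[OF Re_inv[OF v(2)]] by linarith
    then show ?thesis
      using E_pos(3)[OF v(2)] w by (simp add: norm_g v_def[symmetric] divide_le_eq)
  qed
  have "g holomorphic_on {w. - d < Re w}"
  proof -
    have "(\<lambda>w. L (1 / (w + of_real d))) holomorphic_on {w. - d < Re w}"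
    proof (rule holomorphic_on_compose_gen[OF _ hol, unfolded o_def])
      show "(\<lambda>w. 1 / (w + of_real d)) holomorphic_on {w. - d < Re w}"
        by (intro holomorphic_intros) (auto simp: complex_eq_iff)
      show "(\<lambda>w. 1 / (w + of_real d)) ` {w. - d < Re w} \<subseteq> {z. 0 < Re z}"
        using Re_inv by force
    qed
    moreover have "(\<lambda>w. E (w + of_real d) powr of_real Q) holomorphic_on {w. - d < Re w}"
    proof (intro holomorphic_intros)
      show "(\<lambda>w. E (w + of_real d)) holomorphic_on {w. - d < Re w}"
        unfolding E_def using b by (intro holomorphic_intros) auto
      show "E (w + of_real d) \<notin> \<real>\<^sub>\<le>\<^sub>0" if "w \<in> {w. - d < Re w}" for w
        using that by (intro E_pos) auto
    qed
    ultimately show ?thesis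
      unfolding g_def using E_pos(3) by (intro holomorphic_on_divide) fastforce+
  qed
  then have hol_g: "g holomorphic_on {w. 0 < Re w}" and cont_g: "continuous_on {w. 0 \<le> Re w} g"
    using d by (auto elim: holomorphic_on_subset intro: holomorphic_on_imp_continuous_on[OF holomorphic_on_subset])
  define w1 where "w1 = w0 - of_real d"
  have w1: "Re w1 = d" "w1 + of_real d = w0"
    by (simp_all add: w1_def d_def)
  \<comment> \<open>For \<rho>' < \<rho> the gap in the rate absorbs the factor v^C by
    \<open>powr_le_exp\<close>. The resulting constant \<open>A\<close> blows up as \<rho>'
    approaches \<rho>, but it enters only as the real-axis constant, which the conclusion does not
    contain; so \<rho>' may tend to \<rho> afterwards.\<close>
  have decay: "cmod (g w1) \<le> K * exp (- (\<rho>' * d))" if \<rho>': "0 \<le> \<rho>'" "\<rho>' < \<rho>" for \<rho>'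
  proof -
    define A where "A = c * (C / (\<rho> - \<rho>')) powr C"
    have A: "0 \<le> A"
      using c by (simp add: A_def)
    have "cmod (g w1) \<le> K * exp (- (\<rho>' * Re w1))"
    proof (rule half_plane_exponential_decay[of g K "A + K * exp \<rho>'" \<rho>'])
      show "cmod (g (of_real x)) \<le> (A + K * exp \<rho>') * exp (- (\<rho>' * x))" if x: "0 \<le> x" for x
      \<comment> \<open>The assumed decay concerns t = 1/v \<le> 1, that is v = x + d \<ge> 1. For
        smaller x the bound \<open>K\<close> suffices, at the cost of a factor
        \<open>exp \<rho>'\<close>.\<close>
      proof (cases "x + d < 1")
        case True
        then have "\<rho>' * x \<le> \<rho>' * 1"
          using \<rho>' d by (intro mult_left_mono) auto
        then have "1 \<le> exp \<rho>' * exp (- (\<rho>' * x))"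
          by (simp flip: exp_add)
        then have "K * 1 \<le> K * (exp \<rho>' * exp (- (\<rho>' * x)))"
          using K by (intro mult_left_mono) auto
        also have "\<dots> \<le> (A + K * exp \<rho>') * exp (- (\<rho>' * x))"
          using A by (simp add: distrib_right)
        finally show ?thesis
          using g_le[of "of_real x"] x by simp
      next
        case False
        define v where "v = x + d"
        have v: "1 \<le> v" "0 < v"
          using False by (auto simp: v_def)
        have "cmod (g (of_real x)) \<le> cmod (L (1 / of_real v)) / 1"
          unfolding norm_g[of "of_real x", simplified, OF x]
          using E_pos(2,3)[of "of_real v"] v Q
          by (simp only: of_real_add[symmetric] v_def[symmetric]) (use v in \<open>intro divide_left_mono ge_one_powr_ge_zero, auto\<close>)
        also have "\<dots> = cmod (L (of_real (1 / v)))"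
          by simp
        also have "\<dots> \<le> c * (1 / v) powr (- C) * exp (- \<rho> / (1 / v))"
          using v by (intro real) auto
        also have "\<dots> = c * v powr C * exp (- (\<rho> * v))"
          using v by (simp add: powr_divide powr_minus)
        also have "\<dots> \<le> c * ((C / (\<rho> - \<rho>')) powr C * exp ((\<rho> - \<rho>') * v)) * exp (- (\<rho> * v))"
          using powr_le_exp[of v C "\<rho> - \<rho>'"] v C \<rho>' c by (intro mult_right_mono mult_left_mono) auto
        also have "\<dots> = A * exp (- (\<rho>' * v))"
          by (simp add: A_def algebra_simps exp_diff exp_minus divide_inverse)
        also have "\<dots> \<le> (A + K * exp \<rho>') * exp (- (\<rho>' * x))"
          using A K \<rho>' d by (intro mult_mono) (auto simp: v_def intro!: mult_left_mono)
        finally show ?thesis .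
      qed
    qed (use hol_g cont_g g_le K \<rho>' d w1 in auto)
    then show ?thesis
      by (simp add: w1)
  qed
  have "cmod (g w1) \<le> K * exp (- (\<rho> * d))"
  proof (rule le_of_le_mult_exp_small)
    fix \<epsilon> :: real assume "0 < \<epsilon>"
    have "cmod (g w1) \<le> K * exp (- (max 0 (\<rho> - \<epsilon>) * d))"
      using \<open>0 < \<epsilon>\<close> \<rho> by (intro decay) auto
    also have "\<dots> \<le> K * exp (- ((\<rho> - \<epsilon>) * d))"
      using K d by (simp add: mult_right_mono)
    also have "\<dots> = K * exp (- (\<rho> * d)) * exp (\<epsilon> * d)"
      by (simp flip: exp_add add: algebra_simps)
    finally show "cmod (g w1) \<le> K * exp (- (\<rho> * d)) * exp (\<epsilon> * d)" .
  qed
  moreover have "cmod (g w1) = cmod (L z) / cmod (E w0) powr Q"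
    using d by (simp add: norm_g w1) (simp add: w0_def)
  ultimately have "cmod (L z) \<le> cmod (E w0) powr Q * (K * exp (- (\<rho> * d)))"
    using E_pos(3)[of w0] d by (simp add: d_def divide_le_eq mult_ac)
  also have "\<dots> \<le> 2 powr Q * (1 + 1 / Re z) powr (Q / 2) * (K * exp (- (\<rho> * d)))"
  proof (rule mult_right_mono)
    \<comment> \<open>The choice d = Re w0 / 2 makes the price of undoing the division a multiple of
      the original growth: |E w0|^2 \<le> 2 (1 + |w0|^2/d) \<le> 4 (1 + 1/Re z), and 4^(Q/2) =
      2^Q.\<close>
    have w0: "(cmod w0)\<^sup>2 / d = 2 / Re z"
      using Re_one_div[of w0] d by (auto simp: d_def w0_def[symmetric] field_simps) (simp add: w0_def)
    have "cmod (E w0) \<le> 1 + cmod w0 / b"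
      using norm_triangle_ineq[of 1 "w0 / of_real b"] b by (simp add: E_def norm_divide)
    then have "(cmod (E w0))\<^sup>2 \<le> (1 + cmod w0 / b)\<^sup>2"
      by (rule power_mono) simp
    also have "(1 + a)\<^sup>2 \<le> 2 * (1 + a\<^sup>2)" for a :: real
      using zero_le_power2[of "1 - a"] by (simp add: power2_eq_square algebra_simps)
    also have "2 * (1 + (cmod w0 / b)\<^sup>2) = 2 * (1 + (cmod w0)\<^sup>2 / d)"
      by (simp add: power_divide b(2))
    also have "\<dots> \<le> 4 * (1 + 1 / Re z)"
      using z by (simp add: w0)
    finally have "((cmod (E w0))\<^sup>2) powr (Q / 2) \<le> (4 * (1 + 1 / Re z)) powr (Q / 2)"
      using Q by (intro powr_mono2) auto
    moreover have "((cmod (E w0))\<^sup>2) powr (Q / 2) = cmod (E w0) powr Q"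
      using E_pos(3)[of w0] d by (simp flip: powr_numeral add: powr_powr d_def)
    moreover have "(4 * (1 + 1 / Re z)) powr (Q / 2) = 2 powr Q * (1 + 1 / Re z) powr (Q / 2)"
    proof -
      have "4 powr (Q / 2) = (2 powr 2) powr (Q / 2)"
        by simp
      then show ?thesis
        unfolding powr_powr using z by (subst powr_mult) auto
    qed
    ultimately show "cmod (E w0) powr Q \<le> 2 powr Q * (1 + 1 / Re z) powr (Q / 2)"
      by simp
  qed (use K in simp)
  finally show ?thesis
    by (simp add: d_def w0_def mult_ac)
qed

text \<open>The right side is a multiple of a Cauchy density at scale B. With p = B/m the claim is
  that p^(S-1) (1 + p^2) exp(-p^2) is bounded; p^(S-1) \<le> 1 + p^(2S) reduces this to the powers
  0, 1, S, S + 1 of p^2, and each k-th power is at most k! exp(p^2).\<close>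

lemma exp_over_power_le:
  fixes B m :: real
  assumes B: "0 < B" and m: "0 < m" and S: "1 \<le> S"
  shows "exp (- (B\<^sup>2 / m\<^sup>2)) / m ^ Suc S \<le> (2 + fact S + fact (Suc S)) / B ^ Suc S * (B\<^sup>2 / (B\<^sup>2 + m\<^sup>2))"
proof -
  define p where "p = B / m"
  have p: "0 < p"
    using B m by (simp add: p_def)
  obtain T where T: "S = Suc T"
    using S by (cases S) auto
  have "p ^ T \<le> 1 + (p\<^sup>2) ^ S"
  proof (cases "p \<le> 1")
    case True
    then have "p ^ T \<le> 1"
      using p by (intro power_le_one) auto
    moreover have "0 \<le> (p\<^sup>2) ^ S"
      by simp
    ultimately show ?thesis
      by linarith
  next
    case False
    then have "p ^ T \<le> p ^ (2 * S)"
      by (intro power_increasing) (auto simp: T)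
    then show ?thesis
      by (simp add: power_mult)
  qed
  then have "p ^ T * (1 + p\<^sup>2) \<le> (1 + (p\<^sup>2) ^ S) * (1 + p\<^sup>2)"
    by (rule mult_right_mono) simp
  also have "\<dots> = (p\<^sup>2) ^ 0 + (p\<^sup>2) ^ 1 + (p\<^sup>2) ^ S + (p\<^sup>2) ^ Suc S"
    by (simp add: algebra_simps)
  also have "\<dots> \<le> fact 0 * exp (p\<^sup>2) + fact 1 * exp (p\<^sup>2) + fact S * exp (p\<^sup>2) + fact (Suc S) * exp (p\<^sup>2)"
    by (intro add_mono power_le_fact_exp) auto
  also have "\<dots> = (2 + fact S + fact (Suc S)) * exp (p\<^sup>2)"
    by (simp add: distrib_right del: fact_Suc)
  finally have "p ^ T * (1 + p\<^sup>2) * exp (- p\<^sup>2) \<le> 2 + fact S + fact (Suc S)"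
    by (simp add: exp_minus divide_inverse[symmetric] divide_le_eq)
  moreover have "exp (- (B\<^sup>2 / m\<^sup>2)) / m ^ Suc S = p ^ T * (1 + p\<^sup>2) * exp (- p\<^sup>2) / B ^ Suc S * (B\<^sup>2 / (B\<^sup>2 + m\<^sup>2))"
  proof -
    have "B\<^sup>2 / (B\<^sup>2 + m\<^sup>2) = p\<^sup>2 / (1 + p\<^sup>2)"
      using m by (simp add: p_def power_divide field_simps)
    moreover have "1 + p\<^sup>2 \<noteq> 0"
      by (metis add_pos_nonneg less_irrefl zero_le_power2 zero_less_one)
    ultimately have "p ^ T * (1 + p\<^sup>2) * exp (- p\<^sup>2) / B ^ Suc S * (B\<^sup>2 / (B\<^sup>2 + m\<^sup>2)) = (p ^ T * p\<^sup>2) * exp (- p\<^sup>2) / B ^ Suc S"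
      by simp
    also have "p ^ T * p\<^sup>2 = p ^ Suc S"
      by (simp add: T power2_eq_square)
    also have "p ^ Suc S * exp (- p\<^sup>2) / B ^ Suc S = exp (- (B\<^sup>2 / m\<^sup>2)) / m ^ Suc S"
      using B by (simp add: p_def power_divide del: power_Suc)
    finally show ?thesis ..
  qed
  ultimately show ?thesis
    using B by (auto intro!: mult_right_mono divide_right_mono)
qed

section \<open>Superpositions of truncated powers\<close>

lemma norm_combined_integral_le:
  assumes "\<And>k. k < 4 \<Longrightarrow> cmod (\<integral>u. f u \<partial>M k) \<le> b"
  shows "cmod (combined_integral M f) \<le> 4 * b"
proof -
  have "cmod (combined_integral M f) \<le> (\<Sum>k<4. cmod (\<i> ^ k * (\<integral>u. f u \<partial>M k)))"
    unfolding combined_integral_def by (rule norm_sum)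
  also have "\<dots> \<le> (\<Sum>k<(4::nat). b)"
    using assms by (intro sum_mono) (auto simp: norm_mult norm_power)
  finally show ?thesis
    by simp
qed

lemma combined_integral_cong:
  assumes "\<And>k u. k < 4 \<Longrightarrow> u \<in> space (M k) \<Longrightarrow> f u = g u"
  shows "combined_integral M f = combined_integral M g"
  unfolding combined_integral_def using assms by (intro sum.cong refl arg_cong2[of _ _ _ _ "(*)"] Bochner_Integration.integral_cong) auto

lemma combined_integral_mult_left: "combined_integral M (\<lambda>u. c * f u) = c * combined_integral M f"
  by (simp add: combined_integral_def sum_distrib_left mult_ac)

lemma combined_integral_swap:
  assumes fin: "\<And>j. sigma_finite_measure (M j)" "\<And>k. sigma_finite_measure (P k)"
    and int: "\<And>j k. integrable (M j \<Otimes>\<^sub>M P k) (case_prod f)"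
  shows "combined_integral M (\<lambda>u. combined_integral P (\<lambda>v. f u v)) = combined_integral P (\<lambda>v. combined_integral M (\<lambda>u. f u v))"
proof -
  have int1: "integrable (M j) (\<lambda>u. \<integral>v. f u v \<partial>P k)" and int2: "integrable (P k) (\<lambda>v. \<integral>u. f u v \<partial>M j)"
    and swap: "(\<integral>u. (\<integral>v. f u v \<partial>P k) \<partial>M j) = (\<integral>v. (\<integral>u. f u v \<partial>M j) \<partial>P k)" for j k
  proof -
    interpret pair_sigma_finite "M j" "P k"
      using fin by (simp add: pair_sigma_finite_def)
    show "integrable (M j) (\<lambda>u. \<integral>v. f u v \<partial>P k)" "integrable (P k) (\<lambda>v. \<integral>u. f u v \<partial>M j)"
      using integrable_fst[OF int[of j k]] integrable_snd[OF int[of j k]] by auto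
    show "(\<integral>u. (\<integral>v. f u v \<partial>P k) \<partial>M j) = (\<integral>v. (\<integral>u. f u v \<partial>M j) \<partial>P k)"
      by (rule Fubini_integral[OF int, symmetric])
  qed
  have "combined_integral M (\<lambda>u. combined_integral P (\<lambda>v. f u v)) = (\<Sum>j<4. \<Sum>k<4. \<i> ^ j * (\<i> ^ k * (\<integral>u. (\<integral>v. f u v \<partial>P k) \<partial>M j)))"
    unfolding combined_integral_def using int1
    by (simp add: Bochner_Integration.integral_sum sum_distrib_left)
  also have "\<dots> = (\<Sum>k<4. \<Sum>j<4. \<i> ^ k * (\<i> ^ j * (\<integral>v. (\<integral>u. f u v \<partial>M j) \<partial>P k)))"
    unfolding swap by (subst sum.swap) (simp add: mult_ac)
  also have "\<dots> = combined_integral P (\<lambda>v. combined_integral M (\<lambda>u. f u v))"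
    unfolding combined_integral_def using int2
    by (simp add: Bochner_Integration.integral_sum sum_distrib_left)
  finally show ?thesis .
qed

text \<open>Factors in order: S!/(2 pi) of the inversion formula times the pi of the Cauchy
  integral; exp(a x^2) = e; 2^Q from \<open>laplace_transform_decay\<close>; 4 for the four parts of
  the measure; the constant of \<open>exp_over_power_le\<close>; and sqrt 2 from B = r / (sqrt 2 *
  x).\<close>

definition decay_const :: "real \<Rightarrow> nat \<Rightarrow> real" where
  "decay_const Q S = fact S / 2 * (exp 1 * (2 powr Q * (4 * gauss_const Q))) * (2 + fact S + fact (Suc S)) * sqrt 2 ^ S"

lemma decay_const_pos: "0 < decay_const Q S"
  unfolding decay_const_def using gauss_const_pos[of Q]
  by (intro mult_pos_pos divide_pos_pos add_pos_pos) auto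

lemma truncated_power_nonneg: "0 \<le> truncated_power S x"
  by (simp add: truncated_power_def)

section \<open>Truncated powers integrated against a combination of positive measures\<close>

locale growth_family =
  fixes M :: "nat \<Rightarrow> real measure" and Q N :: real
  assumes growth_measure: "growth_measure (M k) Q N"
begin

lemma Q_nonneg: "0 \<le> Q" and N_nonneg: "0 \<le> N"
  using growth_measure[of 0] by (auto simp: growth_measure_def)

definition transform :: "complex \<Rightarrow> complex" where
  "transform z = combined_integral M (\<lambda>u. exp (- z * of_real (u\<^sup>2)))"

lemma transform_holomorphic: "transform holomorphic_on {z. 0 < Re z}"
  unfolding transform_def[abs_def] combined_integral_def
  by (intro holomorphic_intros growth_measure.exp_gauss_integral_holomorphic[OF growth_measure])

lemma norm_transform_le:
  assumes "0 < Re z"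
  shows "cmod (transform z) \<le> 4 * gauss_const Q * N * (1 + 1 / Re z) powr (Q / 2)"
proof -
  have "cmod (transform z) \<le> 4 * (gauss_const Q * N * (1 + 1 / Re z) powr (Q / 2))"
    unfolding transform_def
    by (intro norm_combined_integral_le growth_measure.norm_exp_gauss_integral_le[OF growth_measure assms])
  then show ?thesis
    by (simp add: mult_ac)
qed

lemma truncated_power_combined_integral_eq:
  assumes a: "0 < a" and S: "1 \<le> S"
  shows "integrable lborel (\<lambda>y. laplace_kernel S X (Complex a y) * transform (Complex a y))"
    and "combined_integral M (\<lambda>u. of_real (truncated_power S (X - u\<^sup>2)))
      = fact S / (2 * pi) * (\<integral>y. laplace_kernel S X (Complex a y) * transform (Complex a y) \<partial>lborel)"
proof -
  let ?h = "\<lambda>y. laplace_kernel S X (Complex a y) * transform (Complex a y)"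
  note int = growth_measure.truncated_power_integral_eq(1)[OF growth_measure a S, where X = X]
  note eq = growth_measure.truncated_power_integral_eq(2)[OF growth_measure a S, where X = X]
  have h: "?h y = (\<Sum>k<4. \<i> ^ k * (laplace_kernel S X (Complex a y) * (\<integral>u. exp (- Complex a y * of_real (u\<^sup>2)) \<partial>M k)))" for y
    by (simp add: transform_def combined_integral_def sum_distrib_left mult_ac)
  show "integrable lborel ?h"
    unfolding h using int by simp
  show "combined_integral M (\<lambda>u. of_real (truncated_power S (X - u\<^sup>2))) = fact S / (2 * pi) * (\<integral>y. ?h y \<partial>lborel)"
    unfolding h combined_integral_def eq using int
    by (simp add: Bochner_Integration.integral_sum sum_distrib_left mult_ac)
qed

text \<open>The abscissa a = 1/x^2 balances both costs: exp(a x^2) stays at e and 1 + 1/a = 1 + x^2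
  \<le> (x + 2)^2. Since Re(1/z) = a/|z|^2, the decay factor becomes exp(-B^2/|z|^2), and
  integrating the Cauchy bound leaves B^(-S).\<close>

lemma norm_truncated_power_le_decay:
  assumes S: "1 \<le> S" and r: "0 < r" and x: "0 < x" and c: "0 \<le> c" and C: "0 < C"
    and real: "\<And>t. 0 < t \<Longrightarrow> t \<le> 1 \<Longrightarrow> cmod (transform (of_real t)) \<le> c * t powr (- C) * exp (- (r\<^sup>2) / t)"
  shows "cmod (combined_integral M (\<lambda>u. of_real (truncated_power S (x\<^sup>2 - u\<^sup>2))))
    \<le> decay_const Q S * N * (x + 2) powr Q * (x / r) ^ S"
proof -
  define a where "a = 1 / x\<^sup>2"
  define B where "B = r / (sqrt 2 * x)"
  have a: "0 < a" and B: "0 < B"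
    using x r by (auto simp: a_def B_def)
  have B2: "r\<^sup>2 / 2 * a = B\<^sup>2"
    by (simp add: a_def B_def power_divide power_mult_distrib)
  let ?cS = "2 + fact S + fact (Suc S) :: real"
  define K where "K = 2 powr Q * (4 * gauss_const Q * N) * (x + 2) powr Q"
  have K: "0 \<le> K"
    using gauss_const_pos[of Q] N_nonneg by (simp add: K_def)
  let ?h = "\<lambda>y. laplace_kernel S (x\<^sup>2) (Complex a y) * transform (Complex a y)"
  let ?b = "\<lambda>y. exp 1 * K * ?cS / B ^ Suc S * B\<^sup>2 * (1 / (B\<^sup>2 + y\<^sup>2))"
  have h_le: "cmod (?h y) \<le> ?b y" for y
  proof -
    define m where "m = cmod (Complex a y)"
    have m: "0 < m" "m\<^sup>2 = a\<^sup>2 + y\<^sup>2"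
      using a by (auto simp: m_def complex_eq_iff cmod_power2)
    have "(1 + 1 / a) powr (Q / 2) \<le> (x + 2) powr Q"
    proof -
      have "1 + 1 / a \<le> (x + 2)\<^sup>2"
        using x by (simp add: a_def power2_eq_square algebra_simps)
      then have "(1 + 1 / a) powr (Q / 2) \<le> ((x + 2)\<^sup>2) powr (Q / 2)"
        using a Q_nonneg by (intro powr_mono2) auto
      also have "\<dots> = (x + 2) powr Q"
        using x by (simp flip: powr_numeral add: powr_powr)
      finally show ?thesis .
    qed
    then have K_le: "2 powr Q * (4 * gauss_const Q * N) * (1 + 1 / a) powr (Q / 2) \<le> K"
      unfolding K_def using gauss_const_pos[of Q] N_nonneg by (intro mult_left_mono) auto
    have "cmod (transform (Complex a y)) \<le> 2 powr Q * (4 * gauss_const Q * N) * (1 + 1 / a) powr (Q / 2) * exp (- (r\<^sup>2 / 2 * (a / m\<^sup>2)))"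
      using laplace_transform_decay[OF transform_holomorphic norm_transform_le real _ Q_nonneg c C, of "Complex a y"]
        gauss_const_pos[of Q] N_nonneg r a by (simp add: Re_one_div m_def)
    also have "\<dots> \<le> K * exp (- (r\<^sup>2 / 2 * (a / m\<^sup>2)))"
      using K_le by (rule mult_right_mono) simp
    also have "r\<^sup>2 / 2 * (a / m\<^sup>2) = B\<^sup>2 / m\<^sup>2"
      by (simp add: B2[symmetric])
    finally have "cmod (?h y) \<le> exp 1 / m ^ Suc S * (K * exp (- (B\<^sup>2 / m\<^sup>2)))"
      unfolding norm_mult norm_laplace_kernel m_def[symmetric] using x a m
      by (intro mult_mono) (auto simp: a_def)
    also have "\<dots> = exp 1 * K * (exp (- (B\<^sup>2 / m\<^sup>2)) / m ^ Suc S)"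
      by simp
    also have "\<dots> \<le> exp 1 * K * (?cS / B ^ Suc S * (B\<^sup>2 / (B\<^sup>2 + m\<^sup>2)))"
      using K by (intro mult_left_mono exp_over_power_le B m S) auto
    \<comment> \<open>m^2 = a^2 + y^2 \<ge> y^2, so the density may be enlarged to one in y alone,
      whose integral is explicit.\<close>
    also have "\<dots> \<le> exp 1 * K * (?cS / B ^ Suc S * (B\<^sup>2 / (B\<^sup>2 + y\<^sup>2)))"
      using K B m by (intro mult_left_mono divide_left_mono) (auto intro!: mult_pos_pos add_pos_nonneg)
    finally show ?thesis
      by (simp only: times_divide_eq_right times_divide_eq_left mult_1_right mult.assoc)
  qed
  note int = lebesgue_integral_inverse_sum_squares[OF B]
  have "cmod (\<integral>y. ?h y \<partial>lborel) \<le> (\<integral>y. ?b y \<partial>lborel)"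
    by (intro Bochner_Integration.integral_norm_bound_integral integrable_mult_right int(1) h_le
        truncated_power_combined_integral_eq(1)[OF a S])
  also have "\<dots> = exp 1 * K * ?cS / B ^ Suc S * B\<^sup>2 * (pi / B)"
    by (simp only: integral_mult_right_zero int(2))
  also have "\<dots> = pi * (exp 1 * K * ?cS / B ^ S)"
    using B by (simp add: power2_eq_square)
  finally have "cmod (\<integral>y. ?h y \<partial>lborel) \<le> pi * (exp 1 * K * ?cS / B ^ S)" .
  then have "fact S / (2 * pi) * cmod (\<integral>y. ?h y \<partial>lborel) \<le> fact S / (2 * pi) * (pi * (exp 1 * K * ?cS / B ^ S))"
    by (rule mult_left_mono) simp
  also have "fact S / (2 * pi) * (pi * (exp 1 * K * ?cS / B ^ S)) = fact S / 2 * (exp 1 * K) * ?cS * (1 / B) ^ S"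
    unfolding power_one_over by (simp del: fact_Suc)
  also have "1 / B = sqrt 2 * (x / r)"
    by (simp add: B_def)
  also have "fact S / 2 * (exp 1 * K) * ?cS * (sqrt 2 * (x / r)) ^ S = decay_const Q S * N * (x + 2) powr Q * (x / r) ^ S"
    unfolding power_mult_distrib by (simp add: decay_const_def K_def del: fact_Suc)
  finally show ?thesis
    unfolding truncated_power_combined_integral_eq(2)[OF a S] by (simp add: norm_mult norm_divide)
qed

text \<open>The integrand is at most x^(2S) and already vanishes at u = x, so only the half-open
  interval [0, x) of the growth hypothesis is involved.\<close>

lemma nn_integral_truncated_power_le:
  assumes "0 \<le> x"
  shows "(\<integral>\<^sup>+u. ennreal (truncated_power S (x\<^sup>2 - u\<^sup>2)) \<partial>M k) \<le> ennreal (N * (x + 2) powr Q * x ^ (2 * S))"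
proof -
  interpret growth_measure "M k" Q N
    by (rule growth_measure)
  have "(\<integral>\<^sup>+u. ennreal (truncated_power S (x\<^sup>2 - u\<^sup>2)) \<partial>M k) \<le> (\<integral>\<^sup>+u. ennreal (x ^ (2 * S)) * indicator {0..<x} u \<partial>M k)"
  proof (rule nn_integral_mono)
    fix u assume "u \<in> space (M k)"
    then have u: "0 \<le> u"
      by (simp add: space_M)
    show "ennreal (truncated_power S (x\<^sup>2 - u\<^sup>2)) \<le> ennreal (x ^ (2 * S)) * indicator {0..<x} u"
    proof (cases "u < x")
      case True
      then have "u\<^sup>2 < x\<^sup>2"
        using u by (intro power_strict_mono) auto
      then have "(x\<^sup>2 - u\<^sup>2) ^ S \<le> x ^ (2 * S)"
        unfolding power_mult by (intro power_mono) auto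
      then show ?thesis
        using True u assms \<open>u\<^sup>2 < x\<^sup>2\<close> by (simp add: truncated_power_def ennreal_leI)
    next
      case False
      then have "x\<^sup>2 \<le> u\<^sup>2"
        using assms by (intro power_mono) auto
      then show ?thesis
        by (simp add: truncated_power_def)
    qed
  qed
  also have "\<dots> = ennreal (x ^ (2 * S)) * emeasure (M k) {0..<x}"
    by (rule nn_integral_cmult_indicator) simp
  also have "\<dots> \<le> ennreal (x ^ (2 * S)) * ennreal (N * (x + 2) powr Q)"
    by (rule mult_left_mono[OF growth[OF assms]]) simp
  also have "\<dots> = ennreal (N * (x + 2) powr Q * x ^ (2 * S))"
    using assms by (simp add: ennreal_mult'[symmetric] mult_ac)
  finally show ?thesis .
qed

lemma norm_truncated_power_le:
  assumes "0 \<le> x"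
  shows "cmod (combined_integral M (\<lambda>u. of_real (truncated_power S (x\<^sup>2 - u\<^sup>2))))
    \<le> 4 * (N * (x + 2) powr Q * x ^ (2 * S))"
proof (rule norm_combined_integral_le)
  fix k :: nat
  have "0 \<le> N * (x + 2) powr Q * x ^ (2 * S)"
    using N_nonneg assms by simp
  then have "(\<integral>u. truncated_power S (x\<^sup>2 - u\<^sup>2) \<partial>M k) \<le> N * (x + 2) powr Q * x ^ (2 * S)"
    using nn_integral_truncated_power_le[OF assms] by (intro integral_real_bounded)
  then show "cmod (\<integral>u. of_real (truncated_power S (x\<^sup>2 - u\<^sup>2)) \<partial>M k) \<le> N * (x + 2) powr Q * x ^ (2 * S)"
    by (simp add: truncated_power_nonneg)
qed

end

section \<open>From complex measures to families of positive measures\<close>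

lemma sigma_finite_variation_part:
  assumes "measure_on {0..} \<mu>"
  shows "sigma_finite_measure (variation_part {0..} \<mu> k)"
proof
  let ?M = "variation_part {0..} \<mu> k"
  show "\<exists>A. countable A \<and> A \<subseteq> sets ?M \<and> \<Union>A = space ?M \<and> (\<forall>a\<in>A. emeasure ?M a \<noteq> \<infinity>)"
  proof (intro exI[of _ "range (\<lambda>n::nat. {0..real n})"] conjI)
    show "range (\<lambda>n::nat. {0..real n}) \<subseteq> sets ?M"
      by (auto simp: sets_variation_part sets_restrict_borel)
    show "\<Union>(range (\<lambda>n::nat. {0..real n})) = space ?M"
      by (auto simp: space_variation_part real_arch_simple)
    show "\<forall>a\<in>range (\<lambda>n::nat. {0..real n}). emeasure ?M a \<noteq> \<infinity>"
    proof
      fix a assume "a \<in> range (\<lambda>n::nat. {0..real n})"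
      then obtain n where a: "a = {0..real n}"
        by blast
      have "emeasure ?M a \<le> total_variation \<mu> ({0..} \<inter> {0..real n})"
        unfolding a using emeasure_variation_part_le[OF bounded_additive_of_measure_on[OF assms], of k "{0..real n}"]
        by (simp add: Int_absorb1)
      also have "\<dots> < \<infinity>"
        using assms unfolding measure_on_def by blast
      finally show "emeasure ?M a \<noteq> \<infinity>"
        by simp
    qed
  qed auto
qed

lemma total_variation_le_growth_norm:
  assumes "growth_norm Q \<mu> < \<infinity>" "0 \<le> u"
  shows "total_variation \<mu> {0..<u} \<le> ennreal (enn2real (growth_norm Q \<mu>) * (u + 2) powr Q)"
proof -
  let ?p = "ennreal ((u + 2) powr Q)"
  have p: "?p \<noteq> 0" "?p \<noteq> top"
    using assms(2) by auto
  have "total_variation \<mu> {0..<u} / ?p \<le> growth_norm Q \<mu>"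
    unfolding growth_norm_def using assms(2) by (intro SUP_upper) auto
  then have "total_variation \<mu> {0..<u} / ?p * ?p \<le> growth_norm Q \<mu> * ?p"
    by (rule mult_right_mono) simp
  moreover have "total_variation \<mu> {0..<u} / ?p * ?p = total_variation \<mu> {0..<u}"
    using p by (simp add: ennreal_divide_times)
  moreover have "growth_norm Q \<mu> * ?p = ennreal (enn2real (growth_norm Q \<mu>) * (u + 2) powr Q)"
    using assms by (simp add: ennreal_mult' less_top)
  ultimately show ?thesis
    by simp
qed

lemma growth_family_variation_part:
  assumes "measure_on {0..} \<mu>" "growth_norm Q \<mu> < \<infinity>" "0 \<le> Q"
  shows "growth_family (variation_part {0..} \<mu>) Q (enn2real (growth_norm Q \<mu>))"
proof
  fix k and u :: real assume "0 \<le> u"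
  then show "emeasure (variation_part {0..} \<mu> k) {0..<u} \<le> ennreal (enn2real (growth_norm Q \<mu>) * (u + 2) powr Q)"
    using emeasure_variation_part_le[OF bounded_additive_of_measure_on[OF assms(1)]]
      total_variation_le_growth_norm[OF assms(2)] order_trans by (metis borel_closed closed_atLeast)
qed (use assms in \<open>auto simp: sets_variation_part\<close>)

text \<open>Integrability of \<open>f\<close> need not be checked: otherwise its integral is 0 by
  convention and the bound is trivial.\<close>

lemma norm_integral_le_nn_integral:
  fixes f :: "real \<Rightarrow> complex"
  assumes "\<And>v. v \<in> space M \<Longrightarrow> cmod (f v) \<le> c * g v" "(\<integral>\<^sup>+v. ennreal (g v) \<partial>M) \<le> ennreal V"
    and "g \<in> borel_measurable M" "0 \<le> c" "0 \<le> V"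
  shows "cmod (\<integral>v. f v \<partial>M) \<le> c * V"
proof (cases "integrable M f")
  case True
  have "ennreal (cmod (\<integral>v. f v \<partial>M)) \<le> (\<integral>\<^sup>+v. ennreal (cmod (f v)) \<partial>M)"
    by (rule integral_norm_bound_ennreal[OF True])
  also have "\<dots> \<le> (\<integral>\<^sup>+v. ennreal c * ennreal (g v) \<partial>M)"
    using assms(1,4) by (intro nn_integral_mono) (simp add: ennreal_mult'[symmetric] ennreal_leI)
  also have "\<dots> = ennreal c * (\<integral>\<^sup>+v. ennreal (g v) \<partial>M)"
    using assms(3) by (intro nn_integral_cmult) simp
  also have "\<dots> \<le> ennreal c * ennreal V"
    by (rule mult_left_mono[OF assms(2)]) simp
  also have "\<dots> = ennreal (c * V)"
    using assms(4) by (simp add: ennreal_mult')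
  finally show ?thesis
    using assms(4,5) by simp
next
  case False
  then show ?thesis
    using assms(4,5) by (simp add: not_integrable_integral_eq)
qed

lemma truncated_power_scale:
  assumes "0 < n"
  shows "truncated_power S (v\<^sup>2 - (u / n)\<^sup>2) = truncated_power S ((n * v)\<^sup>2 - u\<^sup>2) / n ^ (2 * S)"
proof -
  have "v\<^sup>2 - (u / n)\<^sup>2 = ((n * v)\<^sup>2 - u\<^sup>2) / n\<^sup>2"
    using assms by (simp add: power_mult_distrib power_divide diff_divide_distrib)
  moreover have "truncated_power S (d / n\<^sup>2) = truncated_power S d / n ^ (2 * S)" for d
    using assms by (simp add: truncated_power_def power_divide power_mult zero_less_divide_iff)
  ultimately show ?thesis
    by simp
qed

lemma borel_measurable_truncated_power [measurable]: "truncated_power S \<in> borel_measurable borel"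
  unfolding truncated_power_def[abs_def] by measurable

context growth_family
begin

text \<open>The two bounds of \<open>x \<mapsto> \<integral>(x\<^sup>2 - u\<^sup>2)\<^sub>+\<^sup>S d\<mu>(u)\<close> yield the two alternatives in \<open>max 1 ((n r)\<^sup>S)\<close>.\<close>

lemma norm_combined_integral_superposition_le:
  fixes P :: "nat \<Rightarrow> real measure" and n :: real
  assumes setsP: "\<And>k. sets (P k) = sets (restrict_space borel {0..})"
    and finP: "\<And>k. sigma_finite_measure (P k)"
    and V1: "\<And>k. (\<integral>\<^sup>+v. ennreal ((v + 2) powr Q * v ^ (2 * S)) \<partial>P k) \<le> ennreal V"
    and V2: "\<And>k. (\<integral>\<^sup>+v. ennreal ((v + 2) powr Q * v ^ S) \<partial>P k) \<le> ennreal V"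
    and V: "0 \<le> V" and S: "1 \<le> S" and n: "1 \<le> n" and r: "0 < r" and c: "0 \<le> c" and C: "0 < C"
    and real: "\<And>t. 0 < t \<Longrightarrow> t \<le> 1 \<Longrightarrow> cmod (transform (of_real t)) \<le> c * t powr (- C) * exp (- (r\<^sup>2) / t)"
  shows "cmod (combined_integral M (\<lambda>u. combined_integral P (\<lambda>v. of_real (truncated_power S (v\<^sup>2 - (u / n)\<^sup>2)))))
    \<le> 4 * (4 + decay_const Q S) * (n powr Q / max 1 ((n * r) ^ S)) * V * N"
proof -
  have spaceP: "space (P k) = {0..}" for k
    using sets_eq_imp_space_eq[OF setsP] by (simp add: space_restrict_space)
  have measP: "f \<in> borel_measurable (P k)" if "f \<in> borel_measurable borel" for f :: "real \<Rightarrow> real" and k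
    using measurable_restrict_space1[OF that] setsP by (metis measurable_cong_sets)
  let ?J = "\<lambda>v. combined_integral M (\<lambda>u. of_real (truncated_power S (v\<^sup>2 - (u / n)\<^sup>2)))"
  let ?I = "\<lambda>x. combined_integral M (\<lambda>u. of_real (truncated_power S (x\<^sup>2 - u\<^sup>2)))"
  have n_pos: "0 < n"
    using n by simp
  have J: "cmod (?J v) = cmod (?I (n * v)) / n ^ (2 * S)" for v
  proof -
    have "?J v = combined_integral M (\<lambda>u. of_real (1 / n ^ (2 * S)) * of_real (truncated_power S ((n * v)\<^sup>2 - u\<^sup>2)))"
      unfolding truncated_power_scale[OF n_pos] by simp
    also have "\<dots> = of_real (1 / n ^ (2 * S)) * ?I (n * v)"
      by (rule combined_integral_mult_left)
    finally show ?thesis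
      using n_pos by (simp add: norm_mult norm_divide norm_power)
  qed
  have powr_le: "(n * v + 2) powr Q \<le> n powr Q * (v + 2) powr Q" if v: "0 \<le> v" for v
  proof -
    have "(n * v + 2) powr Q \<le> (n * (v + 2)) powr Q"
      using n v Q_nonneg by (intro powr_mono2) (auto simp: distrib_left)
    then show ?thesis
      using n v by (simp add: powr_mult)
  qed
  have J1: "cmod (?J v) \<le> 4 * N * n powr Q * ((v + 2) powr Q * v ^ (2 * S))" if v: "0 \<le> v" for v
  proof -
    have "cmod (?J v) \<le> 4 * (N * (n * v + 2) powr Q * (n * v) ^ (2 * S)) / n ^ (2 * S)"
      unfolding J using n v by (intro divide_right_mono norm_truncated_power_le) auto
    also have "\<dots> = 4 * N * v ^ (2 * S) * (n * v + 2) powr Q"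
      using n by (simp add: power_mult_distrib)
    also have "\<dots> \<le> 4 * N * v ^ (2 * S) * (n powr Q * (v + 2) powr Q)"
      using N_nonneg v by (intro mult_left_mono powr_le) auto
    finally show ?thesis
      by (simp add: mult_ac)
  qed
  \<comment> \<open>Here (n v / r)^S / n^(2S) = v^S / (n r)^S, which produces the denominator of the
    theorem and the weight v^S in \<open>V_norm\<close>; in \<open>J1\<close> the powers of n cancel
    altogether. The point v = 0 is separate because the decay estimate requires x > 0.\<close>
  have J2: "cmod (?J v) \<le> decay_const Q S * N * n powr Q / (n * r) ^ S * ((v + 2) powr Q * v ^ S)" if v: "0 \<le> v" for v
  proof (cases "v = 0")
    case True
    then have "?J v = combined_integral M (\<lambda>u. 0)"
      by (simp add: truncated_power_def)
    then show ?thesis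
      using True S by (simp add: combined_integral_def zero_power)
  next
    case False
    have "cmod (?J v) \<le> decay_const Q S * N * (n * v + 2) powr Q * (n * v / r) ^ S / n ^ (2 * S)"
      unfolding J using n v False
      by (intro divide_right_mono norm_truncated_power_le_decay[OF S r _ c C real]) auto
    also have "\<dots> = decay_const Q S * N * v ^ S / (n * r) ^ S * (n * v + 2) powr Q"
      using n r by (simp add: power_mult_distrib power_divide mult_2 mult_2_right power_add field_simps)
    also have "\<dots> \<le> decay_const Q S * N * v ^ S / (n * r) ^ S * (n powr Q * (v + 2) powr Q)"
      using N_nonneg v n r decay_const_pos[of Q S] by (intro mult_left_mono powr_le) auto
    finally show ?thesis
      by (simp add: mult_ac)
  qed
  have fin: "sigma_finite_measure (M j)" for j
  proof -
    interpret growth_measure "M j" Q N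
      by (rule growth_measure)
    show ?thesis
      by (rule sigma_finite_measure_axioms)
  qed
  \<comment> \<open>Absolute integrability, as needed for Fubini, uses the bound without
    cancellation for each pair of positive parts, together with the finiteness in
    \<open>V1\<close>.\<close>
  have int: "integrable (M j \<Otimes>\<^sub>M P k) (\<lambda>(u, v). of_real (truncated_power S (v\<^sup>2 - (u / n)\<^sup>2)) :: complex)" for j k
  proof -
    interpret Mj: growth_measure "M j" Q N
      by (rule growth_measure)
    interpret pair_sigma_finite "M j" "P k"
      using fin finP by (simp add: pair_sigma_finite_def)
    note [measurable del] = Mj.measurable_M
    have [measurable]: "(\<lambda>u. u) \<in> borel_measurable (M j)" "(\<lambda>u. u) \<in> borel_measurable (P k)"
      by (rule Mj.measurable_M measP, simp)+
    have [measurable]: "(\<lambda>(u, v). truncated_power S (v\<^sup>2 - (u / n)\<^sup>2)) \<in> borel_measurable (M j \<Otimes>\<^sub>M P k)"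
      by measurable
    have inner: "(\<integral>\<^sup>+u. ennreal (truncated_power S (v\<^sup>2 - (u / n)\<^sup>2)) \<partial>M j) \<le> ennreal (N * n powr Q) * ennreal ((v + 2) powr Q * v ^ (2 * S))"
      if "v \<in> space (P k)" for v
    proof -
      have v: "0 \<le> v"
        using that by (simp add: spaceP)
      have "(\<integral>\<^sup>+u. ennreal (truncated_power S (v\<^sup>2 - (u / n)\<^sup>2)) \<partial>M j)
          = (\<integral>\<^sup>+u. ennreal (1 / n ^ (2 * S)) * ennreal (truncated_power S ((n * v)\<^sup>2 - u\<^sup>2)) \<partial>M j)"
        unfolding truncated_power_scale[OF n_pos] using n by (simp add: ennreal_mult'[symmetric])
      also have "\<dots> = ennreal (1 / n ^ (2 * S)) * (\<integral>\<^sup>+u. ennreal (truncated_power S ((n * v)\<^sup>2 - u\<^sup>2)) \<partial>M j)"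
        by (intro nn_integral_cmult) measurable
      also have "\<dots> \<le> ennreal (1 / n ^ (2 * S)) * ennreal (N * (n * v + 2) powr Q * (n * v) ^ (2 * S))"
        using n v by (intro mult_left_mono nn_integral_truncated_power_le) auto
      also have "\<dots> = ennreal (N * v ^ (2 * S) * (n * v + 2) powr Q)"
        using n by (simp add: ennreal_mult'[symmetric] power_mult_distrib mult_ac)
      also have "\<dots> \<le> ennreal (N * v ^ (2 * S) * (n powr Q * (v + 2) powr Q))"
        using N_nonneg v by (intro ennreal_leI mult_left_mono powr_le) auto
      finally show ?thesis
        using N_nonneg by (simp add: ennreal_mult'[symmetric] mult_ac)
    qed
    have "(\<integral>\<^sup>+p. ennreal (case p of (u, v) \<Rightarrow> truncated_power S (v\<^sup>2 - (u / n)\<^sup>2)) \<partial>(M j \<Otimes>\<^sub>M P k))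
        = (\<integral>\<^sup>+v. (\<integral>\<^sup>+u. ennreal (truncated_power S (v\<^sup>2 - (u / n)\<^sup>2)) \<partial>M j) \<partial>P k)"
      by (subst nn_integral_snd[symmetric]) auto
    also have "\<dots> \<le> (\<integral>\<^sup>+v. ennreal (N * n powr Q) * ennreal ((v + 2) powr Q * v ^ (2 * S)) \<partial>P k)"
      by (rule nn_integral_mono[OF inner])
    also have "\<dots> = ennreal (N * n powr Q) * (\<integral>\<^sup>+v. ennreal ((v + 2) powr Q * v ^ (2 * S)) \<partial>P k)"
      by (intro nn_integral_cmult measurable_compose[OF measP measurable_ennreal]) measurable
    also have "\<dots> < \<infinity>"
      using le_less_trans[OF V1[of k] ennreal_less_top] by (simp add: ennreal_mult_less_top)
    finally have "integrable (M j \<Otimes>\<^sub>M P k) (\<lambda>(u, v). truncated_power S (v\<^sup>2 - (u / n)\<^sup>2))"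
      by (intro integrableI_nonneg) (auto simp: truncated_power_nonneg)
    then have "integrable (M j \<Otimes>\<^sub>M P k) (\<lambda>p. of_real (case p of (u, v) \<Rightarrow> truncated_power S (v\<^sup>2 - (u / n)\<^sup>2)) :: complex)"
      by simp
    then show ?thesis
      by (simp add: case_prod_unfold)
  qed
  have swap: "combined_integral M (\<lambda>u. combined_integral P (\<lambda>v. of_real (truncated_power S (v\<^sup>2 - (u / n)\<^sup>2)))) = combined_integral P ?J"
    by (rule combined_integral_swap[OF fin finP int])
  have b1: "cmod (combined_integral P ?J) \<le> 4 * (4 * N * n powr Q * V)"
    using J1 V V1 N_nonneg
    by (intro norm_combined_integral_le norm_integral_le_nn_integral[where g = "\<lambda>v. (v + 2) powr Q * v ^ (2 * S)"])
      (auto simp: spaceP intro!: measP)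
  have b2: "cmod (combined_integral P ?J) \<le> 4 * (decay_const Q S * N * n powr Q / (n * r) ^ S * V)"
    using J2 V V2 N_nonneg n r decay_const_pos[of Q S]
    by (intro norm_combined_integral_le norm_integral_le_nn_integral[where g = "\<lambda>v. (v + 2) powr Q * v ^ S"])
      (auto simp: spaceP intro!: measP)
  have nonneg: "0 \<le> n powr Q / (n * r) ^ S * V * N" "0 \<le> n powr Q * V * N"
    using n r V N_nonneg by auto
  show ?thesis
  \<comment> \<open>The case decides which term attains the maximum: \<open>b1\<close> serves the
    denominator 1 and \<open>b2\<close> the denominator (n r)^S.\<close>
  proof (cases "(n * r) ^ S \<le> 1")
    case True
    have "cmod (combined_integral P ?J) \<le> 4 * 4 * (n powr Q * V * N)"
      using b1 by (simp add: mult_ac)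
    also have "\<dots> \<le> 4 * (4 + decay_const Q S) * (n powr Q * V * N)"
      using nonneg decay_const_pos[of Q S] by (intro mult_right_mono) auto
    finally show ?thesis
      unfolding swap using True by (simp add: max_def mult_ac)
  next
    case False
    have "cmod (combined_integral P ?J) \<le> 4 * decay_const Q S * (n powr Q / (n * r) ^ S * V * N)"
      using b2 by (simp add: mult_ac)
    also have "\<dots> \<le> 4 * (4 + decay_const Q S) * (n powr Q / (n * r) ^ S * V * N)"
      using nonneg by (intro mult_right_mono) auto
    finally show ?thesis
      unfolding swap using False by (simp add: max_def mult_ac)
  qed
qed

end

theorem theorem4p3:
  fixes Q c1 C :: real and S :: nat
  assumes "Q > 0" and "c1 > 0" and "C > 0" and "real S > Q + 1"
  shows "\<exists>c>0. \<forall>(\<mu> :: real set \<Rightarrow> complex) (r :: real) (H :: real \<Rightarrow> real)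
                (HS :: real set \<Rightarrow> complex) (n :: real).
           measure_on {0..} \<mu> \<longrightarrow> \<mu> {0} = 0 \<longrightarrow> r > 0 \<longrightarrow>
           growth_norm Q \<mu> < \<infinity> \<longrightarrow>
           (\<forall>t. 0 < t \<and> t \<le> 1 \<longrightarrow>
              cmod (measure_integral UNIV (even_extension \<mu>) (\<lambda>u. exp (- (u ^ 2) * t)))
                \<le> c1 * t powr (- C) * exp (- (r ^ 2) / t) * enn2real (growth_norm Q \<mu>)) \<longrightarrow>
           measure_on {0..} HS \<longrightarrow>
           (\<forall>u\<ge>0. complex_of_real (H u) =
              measure_integral {0..} HS (\<lambda>v. truncated_power S (v ^ 2 - u ^ 2))) \<longrightarrow>
           V_norm Q S HS < \<infinity> \<longrightarrow>
           n \<ge> 1 \<longrightarrow>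
           cmod (measure_integral {0..} \<mu> (\<lambda>u. H (u / n)))
             \<le> c * (n powr Q / max 1 ((n * r) ^ S)) * enn2real (V_norm Q S HS)
                 * enn2real (growth_norm Q \<mu>)"
proof (intro exI[of _ "4 * (4 + decay_const Q S)"] conjI allI impI)
  show "0 < 4 * (4 + decay_const Q S)"
    using decay_const_pos[of Q S] by simp
  fix \<mu> :: "real set \<Rightarrow> complex" and r :: real and H :: "real \<Rightarrow> real"
    and HS :: "real set \<Rightarrow> complex" and n :: real
  assume \<mu>: "measure_on {0..} \<mu>" and r: "0 < r" and growth: "growth_norm Q \<mu> < \<infinity>"
    and decay: "\<forall>t. 0 < t \<and> t \<le> 1 \<longrightarrow>
      cmod (measure_integral UNIV (even_extension \<mu>) (\<lambda>u. exp (- (u ^ 2) * t)))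
        \<le> c1 * t powr (- C) * exp (- (r ^ 2) / t) * enn2real (growth_norm Q \<mu>)"
    and HS: "measure_on {0..} HS"
    and H: "\<forall>u\<ge>0. complex_of_real (H u) = measure_integral {0..} HS (\<lambda>v. truncated_power S (v ^ 2 - u ^ 2))"
    and V: "V_norm Q S HS < \<infinity>" and n: "1 \<le> n"
  let ?N = "enn2real (growth_norm Q \<mu>)" and ?M = "variation_part {0..} \<mu>" and ?P = "variation_part {0..} HS"
  interpret growth_family ?M Q ?N
    using assms by (intro growth_family_variation_part[OF \<mu> growth]) simp
  have "measure_integral {0..} \<mu> (\<lambda>u. H (u / n))
      = combined_integral ?M (\<lambda>u. combined_integral ?P (\<lambda>v. of_real (truncated_power S (v\<^sup>2 - (u / n)\<^sup>2))))"
    unfolding measure_integral_eq_combined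
    using H n by (intro combined_integral_cong) (simp add: space_variation_part measure_integral_eq_combined)
  also have "cmod \<dots> \<le> 4 * (4 + decay_const Q S) * (n powr Q / max 1 ((n * r) ^ S)) * enn2real (V_norm Q S HS) * ?N"
  proof (rule norm_combined_integral_superposition_le)
    show "sets (?P k) = sets (restrict_space borel {0..})" "sigma_finite_measure (?P k)" for k
      by (rule sets_variation_part, rule sigma_finite_variation_part[OF HS])
    have V_eq: "ennreal (enn2real (V_norm Q S HS)) = V_norm Q S HS"
      using V by (simp add: less_top)
    note le = nn_integral_variation_part_le[OF bounded_additive_of_measure_on[OF HS]]
    show "(\<integral>\<^sup>+v. ennreal ((v + 2) powr Q * v ^ (2 * S)) \<partial>?P k) \<le> ennreal (enn2real (V_norm Q S HS))" for k
      unfolding V_eq unfolding V_norm_def by (rule order_trans[OF le max.cobounded1]) simp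
    show "(\<integral>\<^sup>+v. ennreal ((v + 2) powr Q * v ^ S) \<partial>?P k) \<le> ennreal (enn2real (V_norm Q S HS))" for k
      unfolding V_eq unfolding V_norm_def by (rule order_trans[OF le max.cobounded2]) simp
    show "1 \<le> S"
      using assms by linarith
    \<comment> \<open>The norm of \<mu> in the decay hypothesis is merged into the constant
      \<open>c\<close>, which does not occur in the resulting bound.\<close>
    show "0 \<le> c1 * ?N"
      using assms by simp
    show "cmod (transform (of_real t)) \<le> c1 * ?N * t powr (- C) * exp (- (r\<^sup>2) / t)" if t: "0 < t" "t \<le> 1" for t
    proof -
      have "measure_integral UNIV (even_extension \<mu>) (\<lambda>u. exp (- (u ^ 2) * t)) = 2 * measure_integral {0..} \<mu> (\<lambda>u. exp (- (u ^ 2) * t))"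
        by (rule measure_integral_even_extension[OF bounded_additive_of_measure_on[OF \<mu>]]) auto
      also have "measure_integral {0..} \<mu> (\<lambda>u. exp (- (u ^ 2) * t)) = transform (of_real t)"
        unfolding measure_integral_eq_combined transform_def
        by (rule combined_integral_cong) (simp add: exp_of_real[symmetric] mult.commute)
      \<comment> \<open>The hypothesis concerns the integral over the whole line, which is twice the
        transform over the half line; the factor 2 gained here is discarded.\<close>
      finally have "2 * cmod (transform (of_real t)) \<le> c1 * t powr (- C) * exp (- (r ^ 2) / t) * ?N"
        using decay t by (auto simp: norm_mult)
      then show ?thesis
        using norm_ge_zero[of "transform (of_real t)"] by (simp add: mult_ac del: norm_ge_zero)
    qed
  qed (use assms r n in auto)
  finally show "cmod (measure_integral {0..} \<mu> (\<lambda>u. H (u / n)))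
      \<le> 4 * (4 + decay_const Q S) * (n powr Q / max 1 ((n * r) ^ S)) * enn2real (V_norm Q S HS) * ?N" .
qed

end
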